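(* Let $d$ be a positive integer and let $\Lambda=(\lambda_n)_n$ be a random sequence in the polydisc $\mathbb{D}^d$ with prescribed radii $(r_n)_n$ and counting function $(N_m)_{m\in\mathbb{N}^d}$. Then for every positive integer $M$, $$\mathbb{P}\left(\Lambda \text{ is the union of } M \text{ separated sequences}\right)=\begin{cases}1 & \text{if } \sum_{m\in\mathbb{N}^d}N_m^{1+M}2^{-M|m|}<\infty,\\ 0 & \text{if } \sum_{m\in\mathbb{N}^d}N_m^{1+M}2^{-M|m|}=\infty.\end{cases}$$
   Context: Conventions: $\mathbb{N}=\{0,1,2,\dots\}$; for $m=(m_1,\dots,m_d)\in\mathbb{N}^d$, $|m|=m_1+\dots+m_d$. $\mathbb{D}^d=\{z=(z^1,\dots,z^d)\in\mathbb{C}^d : |z^i|<1,\ i=1,\dots,d\}$ (superscripts denote coordinates). Separation: the pseudo-hyperbolic distance in the polydisc is $\rho(z,w)=\max_{i=1,\dots,d}\left|\frac{z^i-w^i}{1-\overline{w^i}z^i}\right|$. A (finite or infinite) sequence $Z=(z_n)_n$ in $\mathbb{D}^d$ is separated if $\inf_{n\ne j}\rho(z_n,z_j)>0$. A sequence $(z_n)_n$ is the union of $M$ separated sequences if its index set can be partitioned into $M$ (possibly finite or empty) subsets, each of which indexes a separated sequence. Random sequence: let $(r_n)_{n\in\mathbb{N}}$ be a deterministic sequence in $(0,1)^d$, $r_n=(r_n^1,\dots,r_n^d)$, and let $\theta_n=(\theta_n^1,\dots,\theta_n^d)$, $n\in\mathbb{N}$, be i.i.d. random variables on a probability space $(\Omega,\mathcal{A},\mathbb{P})$,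 uniformly distributed on the $d$-dimensional torus (identified with $[0,1)^d$). The random sequence is $\Lambda=(\lambda_n)_{n\in\mathbb{N}}$ with $\lambda_n=(r_n^1e^{2\pi i\theta_n^1},\dots,r_n^de^{2\pi i\theta_n^d})$. Counting function: for $m\in\mathbb{N}^d$ let $A_m=\{z\in\mathbb{D}^d : 2^{-(m_i+1)}\le 1-|z^i|<2^{-m_i},\ i=1,\dots,d\}$, and let $N_m\in\mathbb{N}\cup\{\infty\}$ be the (deterministic) number of indices $n$ with $\lambda_n\in A_m$. *)

theory Defs
  imports "HOL-Probability.Probability"
begin

text \<open>
  The dimension \<open>d \<ge> 1\<close> is the cardinality of an arbitrary finite index type \<open>'d\<close>.
\<close>

definition polydisc :: "(complex ^ 'd::finite) set" where
  "polydisc = {z. \<forall>i. norm (z $ i) < 1}"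

definition pseudo_hyp_dist :: "complex ^ 'd::finite \<Rightarrow> complex ^ 'd \<Rightarrow> real" where
  "pseudo_hyp_dist z w =
     Max (range (\<lambda>i. norm ((z $ i - w $ i) / (1 - cnj (w $ i) * z $ i))))"

text \<open>
  \<open>separated_on z I\<close>: the subsequence of \<open>z\<close> indexed by \<open>I\<close> is separated.  The infimum is
  taken in the extended reals, so that sequences with at most one term are separated.
  It ranges over pairs of distinct indices: a repeated point rules out separation.
\<close>
definition separated_on :: "(nat \<Rightarrow> complex ^ 'd::finite) \<Rightarrow> nat set \<Rightarrow> bool" where
  "separated_on z I \<longleftrightarrow>
     (INF (n, j) \<in> {(n, j). n \<in> I \<and> j \<in> I \<and> n \<noteq> j}. ereal (pseudo_hyp_dist (z n) (z j))) > 0"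

lemma separated_on_iff:
  "separated_on z I \<longleftrightarrow>
     (\<exists>\<delta>>0. \<forall>n\<in>I. \<forall>j\<in>I. n \<noteq> j \<longrightarrow> pseudo_hyp_dist (z n) (z j) \<ge> \<delta>)"
proof -
  let ?Q = "{(n, j). n \<in> I \<and> j \<in> I \<and> n \<noteq> j}"
  let ?m = "INF (n, j) \<in> ?Q. ereal (pseudo_hyp_dist (z n) (z j))"
  have le_iff: "ereal c \<le> ?m \<longleftrightarrow>
      (\<forall>n\<in>I. \<forall>j\<in>I. n \<noteq> j \<longrightarrow> pseudo_hyp_dist (z n) (z j) \<ge> c)" for c
    by (auto simp: le_INF_iff)
  have "?m > 0 \<longleftrightarrow> (\<exists>c>0. ereal c \<le> ?m)"
  proof
    assume "?m > 0"
    from ereal_dense2[OF this] obtain c where "0 < ereal c" "ereal c < ?m"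
      by (elim exE conjE)
    then show "\<exists>c>0. ereal c \<le> ?m"
      by (intro exI[of _ c] conjI) (simp only: ereal_less, rule less_imp_le)
  next
    assume "\<exists>c>0. ereal c \<le> ?m"
    then obtain c where c: "c > 0" "ereal c \<le> ?m" by (elim exE conjE)
    from c(1) have "0 < ereal c" by simp
    then show "?m > 0" using c(2) by (rule less_le_trans)
  qed
  then show ?thesis
    by (simp only: separated_on_def le_iff)
qed

definition union_of_separated :: "nat \<Rightarrow> (nat \<Rightarrow> complex ^ 'd::finite) \<Rightarrow> bool" where
  "union_of_separated M z \<longleftrightarrow>
     (\<exists>I. (\<Union>k<M. I k) = UNIV \<and> disjoint_family_on I {..<M} \<and> (\<forall>k<M. separated_on z (I k)))"

definition torus_cube :: "(real ^ 'd::finite) set" where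
  "torus_cube = {x. \<forall>i. 0 \<le> x $ i \<and> x $ i < 1}"

definition random_seq ::
    "(nat \<Rightarrow> real ^ 'd::finite) \<Rightarrow> (nat \<Rightarrow> 'w \<Rightarrow> real ^ 'd) \<Rightarrow> 'w \<Rightarrow> nat \<Rightarrow> complex ^ 'd" where
  "random_seq r \<theta> \<omega> n = (\<chi> i. complex_of_real (r n $ i) * cis (2 * pi * \<theta> n \<omega> $ i))"

definition weight :: "nat ^ 'd::finite \<Rightarrow> nat" where
  "weight m = (\<Sum>i\<in>UNIV. m $ i)"

definition dyadic_region :: "nat ^ 'd::finite \<Rightarrow> (complex ^ 'd) set" where
  "dyadic_region m = {z \<in> polydisc.
     \<forall>i. (1/2) ^ (m $ i + 1) \<le> 1 - norm (z $ i) \<and> 1 - norm (z $ i) < (1/2) ^ (m $ i)}"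

text \<open>The number of indices with \<open>z n\<close> in the region, with value \<open>\<infinity>\<close> if there are infinitely many.\<close>
definition region_count :: "(nat \<Rightarrow> complex ^ 'd::finite) \<Rightarrow> nat ^ 'd \<Rightarrow> ennreal" where
  "region_count z m = emeasure (count_space UNIV) {n. z n \<in> dyadic_region m}"

text \<open>
  The counting function \<open>N\<^sub>m\<close> of the random sequence with radii \<open>r\<close>.  It is deterministic:
  it is defined from the radii alone, and the next lemma shows that it is the
  number of indices with \<open>\<lambda>\<^sub>n \<in> A\<^sub>m\<close> for every outcome.
\<close>
definition counting_fun :: "(nat \<Rightarrow> real ^ 'd::finite) \<Rightarrow> nat ^ 'd \<Rightarrow> ennreal" where
  "counting_fun r m = region_count (\<lambda>n. \<chi> i. complex_of_real (r n $ i)) m"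

lemma region_count_random_seq: "region_count (random_seq r \<theta> \<omega>) m = counting_fun r m"
  by (simp add: counting_fun_def region_count_def dyadic_region_def polydisc_def
      random_seq_def norm_mult)

end

theory Submission
  imports Defs
begin

text \<open>
  Join two indices when their points are at pseudo-hyperbolic distance less than \<open>\<delta>\<close>.  The sequence is
  a union of \<open>M\<close> separated sequences iff for some \<open>\<delta> > 0\<close> this graph has a proper \<open>M\<close>-colouring
  (\<open>union_of_separated_iff_colourable\<close>).  By compactness it suffices to colour finite pieces of the
  graph, so the event is measurable.

  A hyperbolic ball at level \<open>m\<close>, that is in the dyadic region \<open>A\<^sub>m\<close>, occupies a fraction of about
  \<open>2 ^ - |m|\<close> of the torus.  Hence the expected number of \<open>(M + 1)\<close>-sets of mutually close points in that
  region is about \<open>N\<^sub>m ^ (1 + M) * 2 ^ - (M * |m|)\<close>, the term of the series.  Replacing balls by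
  dyadic cells reduces all estimates to finite sums of products.

  If the series converges, the first Borel--Cantelli lemma shows that almost surely only finitely
  many points have at least \<open>M\<close> others within distance \<open>1/17\<close>
  (\<open>AE_finitely_many_crowded\<close>).  As the points are almost surely distinct, decreasing \<open>\<delta>\<close> below the
  finitely many distances at these points isolates them.  Then all degrees in the graph are less
  than \<open>M\<close>, and a greedy colouring exists (\<open>greedy_colouring\<close>).

  If the series diverges, fix \<open>\<delta>\<close> and choose cells of hyperbolic diameter less than \<open>\<delta>\<close>.  A cell with
  \<open>M + 1\<close> points prevents an \<open>M\<close>-colouring.  By Bonferroni's inequality such a cell occurs at level \<open>m\<close>
  with probability at least a constant times the minimum of \<open>1\<close> and the term of the series, as soon
  as the level has enough points (\<open>prob_full_event_ge\<close>,
  \<open>exists_group_with_likely_full_cell\<close>).  The levels involve disjoint sets of indices and are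
  independent, so almost surely some level has a full cell.  This holds for every \<open>\<delta> = 1 / (k + 1)\<close>.
  A level with infinitely many points has a full cell by the pigeonhole principle alone.
\<close>

section \<open>Colourings of countable graphs\<close>

text \<open>
  The de Bruijn--Erdos theorem for a countable graph: the proper colourings of finite pieces,
  extended by a default colour, form a sequence in the compact space of all \<open>M\<close>-colourings, and a
  limit point agrees with one of them on any two given vertices.  It is what makes the event of the
  theorem measurable, since only countably many finite conditions remain.
\<close>

lemma colouring_compactness:
  fixes E :: "nat \<Rightarrow> nat \<Rightarrow> bool"
  assumes fin: "\<And>N. \<exists>c::nat \<Rightarrow> nat. (\<forall>n<N. c n < M) \<and> (\<forall>j<N. \<forall>n<N. E j n \<longrightarrow> c j \<noteq> c n)"
  shows "\<exists>c::nat \<Rightarrow> nat. (\<forall>n. c n < M) \<and> (\<forall>j n. E j n \<longrightarrow> c j \<noteq> c n)"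
proof -
  have "M > 0" using fin[of 1] by auto
  obtain C :: "nat \<Rightarrow> nat \<Rightarrow> nat"
    where C: "\<And>N n. n < N \<Longrightarrow> C N n < M" "\<And>N j n. j < N \<Longrightarrow> n < N \<Longrightarrow> E j n \<Longrightarrow> C N j \<noteq> C N n"
    using fin by metis
  \<comment> \<open>The default colour \<open>0\<close> is admissible since \<open>M > 0\<close>.\<close>
  define D where "D N n = (if n < N then C N n else 0)" for N n
  define K where "K = PiE UNIV (\<lambda>_::nat. {..<M})"
  have "compactin (product_topology (\<lambda>_::nat. euclidean :: nat topology) UNIV) K"
    unfolding K_def by (subst compactin_PiE) (auto simp: compactin_euclidean_iff finite_imp_compact)
  then have "compact K"
    by (simp add: euclidean_product_topology)
  then have "seq_compact K" by (rule compact_imp_seq_compact)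
  moreover have "\<forall>N. D N \<in> K" using C(1) \<open>M > 0\<close> by (auto simp: D_def K_def)
  ultimately obtain l s where l: "l \<in> K" "strict_mono s" "(D \<circ> s) \<longlonglongrightarrow> l"
    unfolding seq_compact_def by blast
  have ev: "\<forall>\<^sub>F k in sequentially. D (s k) n = l n" for n
  proof -
    have "continuous_on UNIV (\<lambda>x::nat\<Rightarrow>nat. x n)" by (rule continuous_on_product_coordinates)
    then have "open ((\<lambda>x::nat\<Rightarrow>nat. x n) -` {l n})"
      by (rule open_vimage[rotated]) (rule Topological_Spaces.open_discrete)
    from topological_tendstoD[OF l(3) this] show ?thesis by simp
  qed
  have "l j \<noteq> l n" if "E j n" for j n
  proof -
    have "\<forall>\<^sub>F k in sequentially. D (s k) j = l j \<and> D (s k) n = l n \<and> k > max j n"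
      using eventually_conj[OF ev[of j] eventually_conj[OF ev[of n] eventually_gt_at_top[of "max j n"]]] .
    then obtain k where k: "D (s k) j = l j" "D (s k) n = l n" "k > max j n"
      using eventually_happens'[OF sequentially_bot] by blast
    have "s k \<ge> k" using l(2) by (rule strict_mono_imp_increasing)
    then show ?thesis using C(2)[of j "s k" n] k that by (auto simp: D_def)
  qed
  then show ?thesis using l(1) by (auto simp: K_def intro!: exI[of _ l])
qed

text \<open>
  Colour the vertices in their order: fewer than \<open>M\<close> colours are forbidden by the earlier
  neighbours.  A degree bound thus replaces any analysis of the connected components of the graph.
\<close>

lemma greedy_colouring:
  fixes E :: "nat \<Rightarrow> nat \<Rightarrow> bool"
  assumes sym: "\<And>j n. E j n \<Longrightarrow> E n j" and irrefl: "\<And>n. \<not> E n n"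
    and deg: "\<And>n. card {j. j < n \<and> E j n} < M"
  shows "\<exists>c::nat \<Rightarrow> nat. (\<forall>n. c n < M) \<and> (\<forall>j n. E j n \<longrightarrow> c j \<noteq> c n)"
proof (rule colouring_compactness)
  fix N
  show "\<exists>c::nat \<Rightarrow> nat. (\<forall>n<N. c n < M) \<and> (\<forall>j<N. \<forall>n<N. E j n \<longrightarrow> c j \<noteq> c n)"
  proof (induction N)
    case 0
    show ?case by simp
  next
    case (Suc N)
    then obtain c :: "nat \<Rightarrow> nat"
      where c: "\<forall>n<N. c n < M" "\<forall>j<N. \<forall>n<N. E j n \<longrightarrow> c j \<noteq> c n" by blast
    have "card (c ` {j. j < N \<and> E j N}) < card {..<M}"
      using card_image_le[of "{j. j < N \<and> E j N}" c] deg[of N] by auto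
    then have "\<not> {..<M} \<subseteq> c ` {j. j < N \<and> E j N}"
      using card_mono[of "c ` {j. j < N \<and> E j N}" "{..<M}"] by auto
    then obtain k where k: "k < M" "k \<notin> c ` {j. j < N \<and> E j N}" by auto
    show ?case
      using c k sym irrefl by (intro exI[of _ "c(N := k)"]) (auto simp: less_Suc_eq)
  qed
qed

section \<open>Chords and pseudo-hyperbolic distance\<close>

text \<open>
  A crude form of Jordan's inequality.  Halving the angle keeps the cosine above \<open>1/2\<close>, which gives
  both factors of \<open>sin x = 2 sin (x/2) cos (x/2)\<close>.
\<close>

lemma sin_ge_quarter:
  fixes x :: real
  assumes "0 \<le> x" "x \<le> pi / 2"
  shows "x / 4 \<le> sin x"
proof -
  have c: "1/2 \<le> cos y" if "0 \<le> y" "y \<le> pi/4" for y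
  proof -
    have "cos (pi/3) \<le> cos y" using that by (intro cos_monotone_0_pi_le) auto
    then show ?thesis by (simp add: cos_60)
  qed
  have s: "y / 2 \<le> sin y" if "0 \<le> y" "y \<le> pi/4" for y
  proof -
    have "sin 0 - 0/2 \<le> sin y - y/2"
    proof (rule DERIV_nonneg_imp_nondecreasing[of 0 y "\<lambda>y. sin y - y/2"])
      fix u assume "0 \<le> u" "u \<le> y"
      then have "0 \<le> cos u - 1/2" using c[of u] that by linarith
      moreover have "((\<lambda>y. sin y - y/2) has_real_derivative cos u - 1/2) (at u)"
        by (auto intro!: derivative_eq_intros)
      ultimately show "\<exists>D. ((\<lambda>y. sin y - y/2) has_real_derivative D) (at u) \<and> 0 \<le> D" by blast
    qed (use that in simp)
    then show ?thesis by simp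
  qed
  have "x / 4 = 2 * ((x/2)/2) * (1/2)" by simp
  also have "\<dots> \<le> 2 * sin (x/2) * cos (x/2)"
    using assms by (intro mult_mono s c) (auto intro!: sin_ge_zero)
  also have "\<dots> = sin x" using sin_double[of "x/2"] by simp
  finally show ?thesis .
qed

lemma norm_cis_diff: "norm (cis a - cis b) = 2 * \<bar>sin ((a - b) / 2)\<bar>"
proof -
  have "(norm (cis a - cis b))\<^sup>2 = (cos a - cos b)\<^sup>2 + (sin a - sin b)\<^sup>2"
    by (simp add: cmod_power2)
  also have "\<dots> = 2 - 2 * cos (a - b)"
  proof -
    have "(cos a - cos b)\<^sup>2 + (sin a - sin b)\<^sup>2
      = ((sin a)\<^sup>2 + (cos a)\<^sup>2) + ((sin b)\<^sup>2 + (cos b)\<^sup>2) - 2 * (cos a * cos b + sin a * sin b)"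
      by (simp add: power2_eq_square algebra_simps)
    then show ?thesis by (simp add: cos_diff)
  qed
  also have "\<dots> = (2 * \<bar>sin ((a - b) / 2)\<bar>)\<^sup>2"
    proof -
    have "cos (a - b) = 1 - 2 * (sin ((a - b) / 2))\<^sup>2"
      using cos_double_sin[of "(a - b) / 2"] by (simp only: nonzero_mult_div_cancel_left mult_2 field_sum_of_halves)
    then show ?thesis by (simp add: power_mult_distrib)
  qed
  finally show ?thesis by (rule power2_eq_imp_eq) auto
qed

text \<open>
  A chord controls the length of the shorter arc, so points that are close in the disc have close
  angles modulo \<open>1\<close>.
\<close>

lemma circle_dist_le_norm_cis_diff:
  fixes a b :: real
  assumes "0 \<le> a" "a < 1" "0 \<le> b" "b < 1"
  shows "min \<bar>a - b\<bar> (1 - \<bar>a - b\<bar>) \<le> norm (cis (2 * pi * a) - cis (2 * pi * b))"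
proof -
  define t where "t = min \<bar>a - b\<bar> (1 - \<bar>a - b\<bar>)"
  have t: "0 \<le> t" "t \<le> 1/2" using assms by (auto simp: t_def min_def)
  have "(2 * pi * a - 2 * pi * b) / 2 = pi * (a - b)" by (simp add: field_simps)
  then have "norm (cis (2 * pi * a) - cis (2 * pi * b)) = 2 * \<bar>sin (pi * (a - b))\<bar>"
    by (simp add: norm_cis_diff)
  also have "\<bar>sin (pi * (a - b))\<bar> = \<bar>sin (pi * \<bar>a - b\<bar>)\<bar>"
    by (cases "a \<ge> b") (auto simp: abs_if algebra_simps sin_diff)
  also have "\<dots> = sin (pi * t)"
  proof (cases "\<bar>a - b\<bar> \<le> 1/2")
    case True
    then have "t = \<bar>a - b\<bar>" by (simp add: t_def)
    moreover have "0 \<le> sin (pi * t)" using t by (intro sin_ge_zero) auto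
    ultimately show ?thesis by simp
  next
    case False
    then have "t = 1 - \<bar>a - b\<bar>" by (auto simp: t_def)
    then have "\<bar>a - b\<bar> = 1 - t" by simp
    then have "sin (pi * \<bar>a - b\<bar>) = sin (pi * t)" by (simp add: right_diff_distrib sin_diff)
    moreover have "0 \<le> sin (pi * t)" using t by (intro sin_ge_zero) auto
    ultimately show ?thesis by simp
  qed
  finally have *: "norm (cis (2 * pi * a) - cis (2 * pi * b)) = 2 * sin (pi * t)" .
  have "pi * t / 4 \<le> sin (pi * t)"
    using t mult_left_mono[OF t(2), of pi] by (intro sin_ge_quarter) auto
  moreover have "2 * t \<le> pi * t" using t pi_gt3 by (intro mult_right_mono) auto
  ultimately show ?thesis using * unfolding t_def[symmetric] by linarith
qed

text \<open>
  Since \<open>1 - cnj w * z = (1 - cnj z * z) + (cnj z - cnj w) * z\<close>, the denominator is at most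
  \<open>2 (1 - norm z) + norm (z - w)\<close>, and the numerator can be absorbed.  The constant \<open>1/17\<close> is chosen to
  give \<open>1/8\<close>, small enough for all later comparisons of dyadic scales.
\<close>

lemma pseudo_hyp_small_imp_close:
  fixes z w :: complex
  assumes "norm z < 1" "norm w < 1" and "norm ((z - w) / (1 - cnj w * z)) < 1/17"
  shows "norm (z - w) < (1 - norm z) / 8"
proof -
  have "norm (cnj w * z) < 1"
    using assms mult_strict_mono'[of "norm w" 1 "norm z" 1] by (simp add: norm_mult)
  then have "1 - cnj w * z \<noteq> 0" by auto
  then have pos: "0 < norm (1 - cnj w * z)" by simp
  have "norm (1 - cnj w * z) = norm ((1 - cnj z * z) + (cnj z - cnj w) * z)"
    by (simp add: algebra_simps)
  also have "\<dots> \<le> norm (1 - cnj z * z) + norm (cnj z - cnj w) * norm z"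
    by (metis norm_triangle_ineq norm_mult)
  also have "norm (1 - cnj z * z) = 1 - (norm z)\<^sup>2"
  proof -
    have "cnj z * z = of_real ((norm z)\<^sup>2)" using complex_norm_square[of z] by (simp add: mult.commute)
    then have "1 - cnj z * z = of_real (1 - (norm z)\<^sup>2)" by simp
    then show ?thesis using assms(1) by (simp only: norm_of_real) (simp add: power_le_one)
  qed
  also have "1 - (norm z)\<^sup>2 = (1 - norm z) * (1 + norm z)" by (simp add: power2_eq_square algebra_simps)
  also have "\<dots> \<le> (1 - norm z) * 2" using assms by (intro mult_left_mono) auto
  also have "norm (cnj z - cnj w) * norm z \<le> norm (z - w) * 1"
    using assms by (intro mult_mono) (auto simp flip: complex_cnj_diff)
  finally have le: "norm (1 - cnj w * z) \<le> 2 * (1 - norm z) + norm (z - w)" by simp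
  have "norm (z - w) < norm (1 - cnj w * z) / 17"
    using assms(3) pos by (simp add: norm_divide field_simps)
  then show ?thesis using le by linarith
qed

lemma pseudo_hyp_le:
  fixes z w :: complex
  assumes "norm z < 1" "norm w \<le> 1" "norm (z - w) \<le> c * (1 - norm z)"
  shows "norm ((z - w) / (1 - cnj w * z)) \<le> c"
proof -
  have "norm (cnj w * z) \<le> norm z"
    using assms by (simp add: norm_mult mult_left_le_one_le)
  then have *: "1 - norm z \<le> norm (1 - cnj w * z)"
    using norm_triangle_ineq2[of 1 "cnj w * z"] by simp
  have "0 \<le> c * (1 - norm z)" using assms(3) norm_ge_zero order_trans by blast
  then have "0 \<le> c" using assms(1) by (simp add: zero_le_mult_iff)
  have "norm (z - w) \<le> c * norm (1 - cnj w * z)"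
    using assms(3) mult_left_mono[OF * \<open>0 \<le> c\<close>] by linarith
  moreover have "0 < norm (1 - cnj w * z)" using * assms(1) by linarith
  ultimately show ?thesis by (simp add: norm_divide field_simps)
qed

lemma norm_polar_diff_le:
  fixes x y a b :: real
  assumes "0 \<le> x" "0 \<le> y" "y \<le> 1"
  shows "norm (of_real x * cis (2 * pi * a) - of_real y * cis (2 * pi * b)) \<le> \<bar>x - y\<bar> + 2 * pi * \<bar>a - b\<bar>"
proof -
  have "of_real x * cis (2 * pi * a) - of_real y * cis (2 * pi * b)
    = of_real (x - y) * cis (2 * pi * a) + of_real y * (cis (2 * pi * a) - cis (2 * pi * b))"
    by (simp add: algebra_simps)
  then have "norm (of_real x * cis (2 * pi * a) - of_real y * cis (2 * pi * b))
    \<le> norm (of_real (x - y) * cis (2 * pi * a)) + norm (of_real y * (cis (2 * pi * a) - cis (2 * pi * b)))"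
    by (metis norm_triangle_ineq)
  also have "norm (of_real (x - y) * cis (2 * pi * a)) = \<bar>x - y\<bar>"
    by (simp only: norm_mult norm_of_real norm_cis) simp
  also have "norm (of_real y * (cis (2 * pi * a) - cis (2 * pi * b))) \<le> 1 * norm (cis (2 * pi * a) - cis (2 * pi * b))"
    unfolding norm_mult using assms by (intro mult_right_mono) auto
  also have "norm (cis (2 * pi * a) - cis (2 * pi * b)) \<le> 2 * pi * \<bar>a - b\<bar>"
  proof -
    have "\<bar>sin ((2 * pi * a - 2 * pi * b) / 2)\<bar> \<le> \<bar>(2 * pi * a - 2 * pi * b) / 2\<bar>"
      by (rule abs_sin_x_le_abs_x)
    also have "\<dots> = pi * \<bar>a - b\<bar>"
      by (simp add: abs_mult flip: right_diff_distrib)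
    finally show ?thesis by (simp add: norm_cis_diff)
  qed
  finally show ?thesis by simp
qed

text \<open>
  Moving the second point radially onto the circle of the first one costs at most the distance of
  the two points, whence the factor \<open>2\<close>.
\<close>

lemma norm_polar_diff_ge:
  fixes x y a b :: real
  assumes "0 \<le> x" "0 \<le> y"
  shows "x * norm (cis (2 * pi * a) - cis (2 * pi * b))
    \<le> 2 * norm (of_real x * cis (2 * pi * a) - of_real y * cis (2 * pi * b))"
proof -
  let ?z = "of_real x * cis (2 * pi * a)" and ?w = "of_real y * cis (2 * pi * b)"
  have "of_real x * (cis (2 * pi * a) - cis (2 * pi * b)) = (?z - ?w) + of_real (y - x) * cis (2 * pi * b)"
    by (simp add: algebra_simps)
  then have "norm (of_real x * (cis (2 * pi * a) - cis (2 * pi * b)))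
    \<le> norm (?z - ?w) + norm (of_real (y - x) * cis (2 * pi * b))"
    by (metis norm_triangle_ineq)
  moreover have "norm (of_real x * (cis (2 * pi * a) - cis (2 * pi * b))) = x * norm (cis (2 * pi * a) - cis (2 * pi * b))"
    unfolding norm_mult using assms by simp
  moreover have "norm (of_real (y - x) * cis (2 * pi * b)) = \<bar>y - x\<bar>"
    by (simp only: norm_mult norm_of_real norm_cis) simp
  moreover have "\<bar>y - x\<bar> \<le> norm (?z - ?w)"
    using norm_triangle_ineq3[of ?z ?w] assms by (simp add: norm_mult abs_minus_commute)
  ultimately show ?thesis by linarith
qed

lemma pseudo_hyp_dist_ge_iff:
  "c \<le> pseudo_hyp_dist z w \<longleftrightarrow> (\<exists>i. c \<le> norm ((z $ i - w $ i) / (1 - cnj (w $ i) * z $ i)))"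
  unfolding pseudo_hyp_dist_def by (subst Max_ge_iff) auto

lemma pseudo_hyp_dist_sym: "pseudo_hyp_dist z w = pseudo_hyp_dist w z"
proof -
  have "norm ((z $ i - w $ i) / (1 - cnj (w $ i) * z $ i)) = norm ((w $ i - z $ i) / (1 - cnj (z $ i) * w $ i))" for i
  proof -
    have "norm (1 - cnj (w $ i) * z $ i) = norm (cnj (1 - cnj (w $ i) * z $ i))"
      by (simp only: complex_mod_cnj)
    then show ?thesis by (simp add: norm_divide norm_minus_commute mult.commute)
  qed
  then show ?thesis unfolding pseudo_hyp_dist_def by simp
qed

lemma pseudo_hyp_dist_pos:
  assumes "z \<in> polydisc" "w \<in> polydisc" "z \<noteq> w"
  shows "0 < pseudo_hyp_dist z w"
proof -
  obtain i where i: "z $ i \<noteq> w $ i" using assms(3) by (auto simp: vec_eq_iff)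
  have "norm (cnj (w $ i) * z $ i) < 1"
    using assms(1,2) mult_strict_mono'[of "norm (w $ i)" 1 "norm (z $ i)" 1]
    by (simp add: norm_mult polydisc_def)
  then have "1 - cnj (w $ i) * z $ i \<noteq> 0" by auto
  then have "0 < norm ((z $ i - w $ i) / (1 - cnj (w $ i) * z $ i))" using i by simp
  also have "\<dots> \<le> pseudo_hyp_dist z w" using pseudo_hyp_dist_ge_iff by blast
  finally show ?thesis .
qed

section \<open>Dyadic levels and cells\<close>

text \<open>
  The rings partition the radii in order, so the bound at the outer edge of a ring determines its
  index by minimality.
\<close>

definition ring_index :: "real \<Rightarrow> nat" where
  "ring_index x = (LEAST k. (1/2) ^ (k + 1) \<le> 1 - x)"

lemma ring_index_bounds:
  assumes "0 < x" "x < 1"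
  shows "(1/2) ^ (ring_index x + 1) \<le> 1 - x" "1 - x < (1/2) ^ ring_index x"
proof -
  have "\<exists>k. (1/2::real) ^ k < 1 - x" using assms by (intro real_arch_pow_inv) auto
  then obtain k where "(1/2::real) ^ k < 1 - x" by blast
  then have "(1/2) ^ (k + 1) \<le> 1 - x"
    using power_decreasing[of k "k + 1" "1/2::real"] by linarith
  then show le: "(1/2) ^ (ring_index x + 1) \<le> 1 - x"
    unfolding ring_index_def by (rule LeastI)
  show "1 - x < (1/2) ^ ring_index x"
  proof (cases "ring_index x")
    case 0
    then show ?thesis using assms by simp
  next
    case (Suc k)
    then have "\<not> (1/2) ^ (k + 1) \<le> 1 - x"
      using not_less_Least[of k "\<lambda>k. (1/2) ^ (k + 1) \<le> 1 - x"] unfolding ring_index_def by auto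
    then show ?thesis using Suc by simp
  qed
qed

lemma half_pow_less_imp: "(1/2::real) ^ a < (1/2) ^ b \<Longrightarrow> b < a"
  by (rule ccontr) (use power_decreasing[of a b "1/2::real"] in auto)

lemma ring_index_unique:
  assumes "0 < x" "x < 1" "(1/2) ^ (k + 1) \<le> 1 - x" "1 - x < (1/2) ^ k"
  shows "ring_index x = k"
proof -
  have "(1/2::real) ^ (k + 1) < (1/2) ^ ring_index x" "(1/2::real) ^ (ring_index x + 1) < (1/2) ^ k"
    using assms ring_index_bounds[of x] by auto
  from half_pow_less_imp[OF this(1)] half_pow_less_imp[OF this(2)] show ?thesis by simp
qed

definition level :: "real ^ 'd::finite \<Rightarrow> nat ^ 'd" where
  "level x = (\<chi> i. ring_index (x $ i))"

lemma counting_fun_eq: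
  fixes r :: "nat \<Rightarrow> real ^ 'd::finite"
  assumes "\<And>n i. 0 < r n $ i \<and> r n $ i < 1"
  shows "counting_fun r m = emeasure (count_space UNIV) {n. level (r n) = m}"
proof -
  have "((\<chi> i. complex_of_real (r n $ i)) \<in> dyadic_region m) = (level (r n) = m)" for n
  proof -
    have "\<bar>r n $ i\<bar> = r n $ i" for i using assms[of n i] by simp
    then have "(\<chi> i. complex_of_real (r n $ i)) \<in> dyadic_region m
      \<longleftrightarrow> (\<forall>i. (1/2) ^ (m $ i + 1) \<le> 1 - r n $ i \<and> 1 - r n $ i < (1/2) ^ (m $ i))"
      using assms by (simp add: dyadic_region_def polydisc_def)
    also have "\<dots> \<longleftrightarrow> (\<forall>i. ring_index (r n $ i) = m $ i)"
      using assms ring_index_bounds ring_index_unique by metis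
    finally show ?thesis by (simp add: level_def vec_eq_iff)
  qed
  then show ?thesis by (simp add: counting_fun_def region_count_def)
qed

text \<open>
  The dyadic boxes of side lengths \<open>2 ^ - q $ i\<close>.  The index \<open>b\<close> may exceed the range \<open>cells q\<close> of
  boxes inside the unit cube, which spares case distinctions for the neighbours of a box.
\<close>

definition cell :: "nat ^ 'd::finite \<Rightarrow> ('d \<Rightarrow> nat) \<Rightarrow> (real ^ 'd) set" where
  "cell q b = {x. \<forall>i. real (b i) \<le> 2 ^ (q $ i) * x $ i \<and> 2 ^ (q $ i) * x $ i < real (b i) + 1}"

definition cells :: "nat ^ 'd::finite \<Rightarrow> ('d \<Rightarrow> nat) set" where
  "cells q = PiE UNIV (\<lambda>i. {..<2 ^ (q $ i)})"

lemma finite_cells [simp]: "finite (cells q)"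
  unfolding cells_def by (intro finite_PiE) auto

lemma card_cells: "card (cells q) = 2 ^ weight q"
  unfolding cells_def weight_def by (subst card_PiE) (auto simp: power_sum)

lemma cell_unique: "x \<in> cell q b \<Longrightarrow> x \<in> cell q c \<Longrightarrow> b = c"
proof (rule ext)
  fix i assume "x \<in> cell q b" "x \<in> cell q c"
  then have "real (b i) \<le> 2 ^ (q $ i) * x $ i" "2 ^ (q $ i) * x $ i < real (b i) + 1"
    "real (c i) \<le> 2 ^ (q $ i) * x $ i" "2 ^ (q $ i) * x $ i < real (c i) + 1"
    by (auto simp: cell_def)
  then have "real (b i) < real (c i) + 1" "real (c i) < real (b i) + 1" by linarith+
  then show "b i = c i" by linarith
qed

lemma torus_cube_in_cell:
  assumes "x \<in> torus_cube"
  obtains b where "b \<in> cells q" "x \<in> cell q b"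
proof
  let ?b = "\<lambda>i. nat \<lfloor>2 ^ (q $ i) * x $ i\<rfloor>"
  have x: "0 \<le> x $ i" "x $ i < 1" for i using assms by (auto simp: torus_cube_def)
  then have nn: "0 \<le> 2 ^ (q $ i) * x $ i" for i by simp
  show "x \<in> cell q ?b"
    using nn by (auto simp: cell_def) 
  have "?b i < 2 ^ (q $ i)" for i
  proof -
    have "2 ^ (q $ i) * x $ i < 2 ^ (q $ i) * 1" using x by (intro mult_strict_left_mono) auto
    then have "\<lfloor>2 ^ (q $ i) * x $ i\<rfloor> < 2 ^ (q $ i)" by (simp add: floor_less_iff)
    then show ?thesis by (simp add: nat_less_iff nn)
  qed
  then show "?b \<in> cells q" by (simp only: cells_def PiE_UNIV_domain Pi_iff lessThan_iff) simp
qed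

lemma cell_subset_torus_cube:
  assumes "b \<in> cells q"
  shows "cell q b \<subseteq> torus_cube"
proof (clarsimp simp: torus_cube_def cell_def)
  fix x :: "real ^ 'a" and i
  assume "\<forall>i. real (b i) \<le> 2 ^ (q $ i) * x $ i \<and> 2 ^ (q $ i) * x $ i < real (b i) + 1"
  then have x: "real (b i) \<le> 2 ^ (q $ i) * x $ i" "2 ^ (q $ i) * x $ i < real (b i) + 1" by auto
  have "b i < 2 ^ (q $ i)" using assms by (auto simp: cells_def)
  then have "b i + 1 \<le> 2 ^ (q $ i)" by simp
  then have "real (b i + 1) \<le> real (2 ^ (q $ i))" by (rule of_nat_mono)
  then have "real (b i) + 1 \<le> 2 ^ (q $ i)" by simp
  then have "2 ^ (q $ i) * x $ i < 2 ^ (q $ i) * 1" using x by linarith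
  moreover have "0 \<le> 2 ^ (q $ i) * x $ i" using x(1) of_nat_0_le_iff order_trans by blast
  ultimately show "0 \<le> x $ i \<and> x $ i < 1"
    by (simp only: zero_le_mult_iff mult_less_cancel_left) (auto simp: not_less)
qed

lemma cell_measurable [measurable]: "cell q b \<in> sets borel"
proof -
  have "cell q b = {x\<in>space borel. \<forall>i\<in>UNIV. real (b i) \<le> 2 ^ (q $ i) * x $ i \<and> 2 ^ (q $ i) * x $ i < real (b i) + 1}"
    by (auto simp: cell_def)
  also have "\<dots> \<in> sets borel" by measurable
  finally show ?thesis .
qed

lemma torus_cube_measurable [measurable]: "torus_cube \<in> sets borel"
proof -
  have "torus_cube = {x\<in>space borel. \<forall>i\<in>UNIV. 0 \<le> x $ i \<and> x $ i < 1}"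
    by (auto simp: torus_cube_def)
  also have "\<dots> \<in> sets borel" by measurable
  finally show ?thesis .
qed

text \<open>
  The half-open box lies between the open and the closed one, which have equal measure.
\<close>

lemma emeasure_half_open_box:
  fixes u v :: "real ^ 'd::finite"
  assumes "\<And>i. u $ i < v $ i"
  shows "emeasure lborel {x. \<forall>i. u $ i \<le> x $ i \<and> x $ i < v $ i} = ennreal (\<Prod>i\<in>UNIV. v $ i - u $ i)"
proof (rule antisym)
  let ?H = "{x. \<forall>i. u $ i \<le> x $ i \<and> x $ i < v $ i}"
  have H: "?H \<in> sets lborel"
  proof -
    have "?H = {x\<in>space borel. \<forall>i\<in>UNIV. u $ i \<le> x $ i \<and> x $ i < v $ i}" by auto
    also have "\<dots> \<in> sets borel" by measurable
    finally show ?thesis by simp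
  qed
  have "box u v \<noteq> {}" using assms by (auto simp: interval_ne_empty_cart)
  have m: "measure lborel (cbox u v) = (\<Prod>i\<in>UNIV. v $ i - u $ i)"
    using assms content_cbox_cart[of u v] by (force simp: interval_ne_empty_cart intro: less_imp_le)
  have c: "emeasure lborel (cbox u v) = ennreal (\<Prod>i\<in>UNIV. v $ i - u $ i)"
    unfolding m[symmetric] using emeasure_lborel_cbox_finite[of u v]
    by (intro emeasure_eq_ennreal_measure) auto
  have o: "emeasure lborel (box u v) = emeasure lborel (cbox u v)"
    by (simp add: emeasure_lborel_box_eq emeasure_lborel_cbox_eq)
  have "emeasure lborel ?H \<le> emeasure lborel (cbox u v)"
    by (intro emeasure_mono) (auto simp: mem_box_cart less_imp_le)
  then show "emeasure lborel ?H \<le> ennreal (\<Prod>i\<in>UNIV. v $ i - u $ i)" by (simp add: c)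
  have "emeasure lborel (box u v) \<le> emeasure lborel ?H"
    using H by (intro emeasure_mono) (auto simp: mem_box_cart less_imp_le)
  then show "ennreal (\<Prod>i\<in>UNIV. v $ i - u $ i) \<le> emeasure lborel ?H" by (simp add: c o)
qed

lemma emeasure_lborel_cell: "emeasure lborel (cell q b) = ennreal ((1/2) ^ weight q)"
proof -
  have eq: "cell q b = {x. \<forall>i. (\<chi> i. real (b i) / 2 ^ (q $ i)) $ i \<le> x $ i \<and> x $ i < (\<chi> i. (real (b i) + 1) / 2 ^ (q $ i)) $ i}"
    by (auto simp: cell_def field_simps)
  show ?thesis
    unfolding eq weight_def
    by (subst emeasure_half_open_box)
      (auto simp: field_simps power_sum prod_dividef power_divide simp flip: diff_divide_distrib)
qed

lemma emeasure_lborel_torus_cube: "emeasure lborel (torus_cube :: (real^'d::finite) set) = 1"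
proof -
  have eq: "torus_cube = {x :: real^'d. \<forall>i. (0::real^'d) $ i \<le> x $ i \<and> x $ i < (1::real^'d) $ i}"
    by (auto simp: torus_cube_def)
  show ?thesis unfolding eq by (subst emeasure_half_open_box) auto
qed

lemma measure_uniform_cell:
  assumes "b \<in> cells q"
  shows "measure (uniform_measure lborel torus_cube) (cell q b) = (1/2) ^ weight q"
  using cell_subset_torus_cube[OF assms] 
  by (simp add: measure_def emeasure_lborel_torus_cube emeasure_lborel_cell Int_absorb1 divide_ennreal_def)

lemma measure_uniform_cell_le:
  "measure (uniform_measure lborel torus_cube) (cell q b) \<le> (1/2) ^ weight q"
proof -
  have "emeasure (uniform_measure lborel torus_cube) (cell q b) \<le> ennreal ((1/2) ^ weight q)"
    using emeasure_mono[of "torus_cube \<inter> cell q b" "cell q b" lborel]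
    by (simp add: emeasure_lborel_torus_cube emeasure_lborel_cell divide_ennreal_def)
  then show ?thesis unfolding measure_def by (intro enn2real_leI) auto
qed

section \<open>Close points lie in neighbouring cells\<close>

text \<open>
  A set containing all dyadic intervals that meet the arc of radius \<open>1/Q\<close> about a point of interval \<open>p\<close>.  The end
  intervals \<open>0\<close> and \<open>Q - 1\<close> are always included: they are adjacent on the circle, so this avoids
  arithmetic modulo \<open>Q\<close> and costs only a constant.
\<close>

definition neighbours :: "nat \<Rightarrow> nat \<Rightarrow> nat set" where
  "neighbours Q p = {p, p + 1, p - 1, Q - 1, 0}"

lemma card_neighbours: "card (neighbours Q p) \<le> 5"
  unfolding neighbours_def by (rule order_trans[OF card_insert_le_m1]) (auto intro!: card_insert_le_m1)

lemma finite_neighbours [simp]: "finite (neighbours Q p)"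
  by (simp add: neighbours_def)

text \<open>
  Pseudo-hyperbolically close points have comparable distances to the boundary, so their ring
  indices differ by at most one, and their angles are closer than the side of a dyadic interval of
  the corresponding scale.  In the outermost ring \<open>k = 0\<close> the radius may be tiny and the angle carries
  no information, but there the only interval is the whole circle.
\<close>

lemma near_coordinate:
  fixes x y a b :: real
  defines "z \<equiv> of_real x * cis (2 * pi * a)" and "w \<equiv> of_real y * cis (2 * pi * b)"
    and "k \<equiv> ring_index x"
  assumes x: "0 < x" "x < 1" and y: "0 < y" "y < 1" and a: "0 \<le> a" "a < 1" and b: "0 \<le> b" "b < 1"
    and near: "norm ((z - w) / (1 - cnj w * z)) < 1/17"
    and p: "real p \<le> 2 ^ k * a" "2 ^ k * a < real p + 1"
  shows "ring_index y \<le> k + 1" "k \<le> ring_index y + 1"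
    and "\<exists>c\<in>neighbours (2 ^ k) p. real c \<le> 2 ^ k * b \<and> 2 ^ k * b < real c + 1"
proof -
  have norms: "norm z = x" "norm w = y" using x y by (auto simp: z_def w_def norm_mult)
  then have close: "norm (z - w) < (1 - x) / 8"
    using pseudo_hyp_small_imp_close[of z w] x y near by simp
  have xy: "\<bar>x - y\<bar> \<le> norm (z - w)" using norm_triangle_ineq3[of z w] norms by simp
  note bx = ring_index_bounds[OF x, folded k_def] and bdy = ring_index_bounds[OF y]
  have "(1/2::real) ^ (k + 2) < (1/2) ^ ring_index y"
    using bx bdy close xy by simp
  from half_pow_less_imp[OF this] show "ring_index y \<le> k + 1" by simp
  have "(1/2::real) ^ (ring_index y + 2) < (1/2) ^ k"
    using bx bdy close xy by simp
  from half_pow_less_imp[OF this] show "k \<le> ring_index y + 1" by simp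
  show "\<exists>c\<in>neighbours (2 ^ k) p. real c \<le> 2 ^ k * b \<and> 2 ^ k * b < real c + 1"
  proof (cases "k = 0")
    case True
    then show ?thesis using b by (intro bexI[of _ 0]) (auto simp: neighbours_def)
  next
    case False
    then have "(1/2::real) ^ k \<le> (1/2) ^ 1" by (intro power_decreasing) auto
    then have half: "1/2 \<le> x" using bx by simp
    have "1/2 * norm (cis (2 * pi * a) - cis (2 * pi * b)) \<le> x * norm (cis (2 * pi * a) - cis (2 * pi * b))"
      using half by (intro mult_right_mono) auto
    also have "\<dots> \<le> 2 * norm (z - w)"
      unfolding z_def w_def using x y by (intro norm_polar_diff_ge) auto
    finally have "norm (cis (2 * pi * a) - cis (2 * pi * b)) < (1 - x) / 2"
      using close by simp
    then have "norm (cis (2 * pi * a) - cis (2 * pi * b)) < (1/2) ^ k"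
      using bx(2) x by simp
    then have "min \<bar>a - b\<bar> (1 - \<bar>a - b\<bar>) < (1/2) ^ k"
      using circle_dist_le_norm_cis_diff[OF a b] by linarith
    then have "\<bar>a - b\<bar> < (1/2) ^ k \<or> 1 - \<bar>a - b\<bar> < (1/2) ^ k" by (simp add: min_less_iff_disj)
    then have "2 ^ k * \<bar>a - b\<bar> < 1 \<or> 2 ^ k - 2 ^ k * \<bar>a - b\<bar> < 1"
      by (simp add: power_divide field_simps)
    moreover have "2 ^ k * \<bar>a - b\<bar> = \<bar>2 ^ k * a - 2 ^ k * b\<bar>"
      by (simp add: abs_mult flip: right_diff_distrib)
    moreover have scaled: "0 \<le> 2 ^ k * a" "2 ^ k * a < 2 ^ k" "0 \<le> 2 ^ k * b" "2 ^ k * b < 2 ^ k"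
      using a b by auto
    ultimately consider "\<bar>2 ^ k * a - 2 ^ k * b\<bar> < 1" | "2 ^ k * b < 1" | "2 ^ k - 1 < 2 ^ k * b"
      by linarith
    then show ?thesis
    proof cases
      case 1
      define c where "c = nat \<lfloor>2 ^ k * b\<rfloor>"
      have c: "real c \<le> 2 ^ k * b" "2 ^ k * b < real c + 1" using scaled by (auto simp: c_def)
      then have "real c < real p + 2" "real p < real c + 2" using 1 p by linarith+
      then have "c = p \<or> c = p + 1 \<or> c = p - 1" by linarith
      then show ?thesis using c by (auto simp: neighbours_def)
    next
      case 2
      then show ?thesis using scaled by (intro bexI[of _ 0]) (auto simp: neighbours_def)
    next
      case 3
      then show ?thesis using scaled by (intro bexI[of _ "2 ^ k - 1"]) (auto simp: neighbours_def of_nat_diff)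
    qed
  qed
qed

definition torus_point :: "real ^ 'd::finite \<Rightarrow> real ^ 'd \<Rightarrow> complex ^ 'd" where
  "torus_point x t = (\<chi> i. complex_of_real (x $ i) * cis (2 * pi * t $ i))"

lemma random_seq_eq: "random_seq r \<theta> \<omega> n = torus_point (r n) (\<theta> n \<omega>)"
  by (simp add: random_seq_def torus_point_def)

definition near_levels :: "nat ^ 'd::finite \<Rightarrow> (nat ^ 'd) set" where
  "near_levels m = {m'. \<forall>i. m' $ i \<le> m $ i + 1 \<and> m $ i \<le> m' $ i + 1}"

definition near_cells :: "nat ^ 'd::finite \<Rightarrow> ('d \<Rightarrow> nat) \<Rightarrow> ('d \<Rightarrow> nat) set" where
  "near_cells q b = PiE UNIV (\<lambda>i. neighbours (2 ^ (q $ i)) (b i))"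

lemma finite_near_cells [simp]: "finite (near_cells q b)"
  unfolding near_cells_def by (intro finite_PiE) auto

lemma card_near_cells: "card (near_cells q (b :: 'd::finite \<Rightarrow> nat)) \<le> 5 ^ CARD('d)"
proof -
  have "card (near_cells q b) = (\<Prod>i\<in>UNIV. card (neighbours (2 ^ (q $ i)) (b i)))"
    unfolding near_cells_def by (rule card_PiE) simp
  also have "\<dots> \<le> (\<Prod>i\<in>(UNIV::'d set). 5)" by (intro prod_mono) (auto simp: card_neighbours)
  finally show ?thesis by simp
qed

text \<open>
  What closeness means combinatorially: an adjacent level and one of boundedly many cells, all at the
  scale of the first point.
\<close>

lemma near_imp_near_level_and_cell:
  fixes x y s t :: "real ^ 'd::finite"
  assumes x: "\<And>i. 0 < x $ i \<and> x $ i < 1" and y: "\<And>i. 0 < y $ i \<and> y $ i < 1"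
    and s: "s \<in> torus_cube" and t: "t \<in> torus_cube"
    and near: "pseudo_hyp_dist (torus_point x s) (torus_point y t) < 1/17"
    and b: "s \<in> cell (level x) b"
  shows "level y \<in> near_levels (level x)" and "\<exists>c\<in>near_cells (level x) b. t \<in> cell (level x) c"
proof -
  have coord: "ring_index (y $ i) \<le> ring_index (x $ i) + 1 \<and> ring_index (x $ i) \<le> ring_index (y $ i) + 1
    \<and> (\<exists>c\<in>neighbours (2 ^ ring_index (x $ i)) (b i).
        real c \<le> 2 ^ ring_index (x $ i) * t $ i \<and> 2 ^ ring_index (x $ i) * t $ i < real c + 1)" for i
  proof -
    have n: "norm ((torus_point x s $ i - torus_point y t $ i) / (1 - cnj (torus_point y t $ i) * torus_point x s $ i)) < 1/17"
      using near pseudo_hyp_dist_ge_iff[of "1/17" "torus_point x s" "torus_point y t"]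
      by (auto simp: not_le[symmetric])
    show ?thesis
      using near_coordinate[of "x $ i" "y $ i" "s $ i" "t $ i" "b i"] x[of i] y[of i] s t b n
      by (auto simp: torus_cube_def cell_def level_def torus_point_def)
  qed
  then show "level y \<in> near_levels (level x)" by (simp add: near_levels_def level_def)
  from coord obtain c where c: "\<And>i. c i \<in> neighbours (2 ^ ring_index (x $ i)) (b i)"
      "\<And>i. real (c i) \<le> 2 ^ ring_index (x $ i) * t $ i"
      "\<And>i. 2 ^ ring_index (x $ i) * t $ i < real (c i) + 1" by metis
  then show "\<exists>c\<in>near_cells (level x) b. t \<in> cell (level x) c"
    by (intro bexI[of _ c]) (auto simp: near_cells_def cell_def level_def)
qed

section \<open>Separation as colourability\<close>

text \<open>
  Separation with a prescribed constant: a partition into \<open>M\<close> pieces with separation constant \<open>\<delta>\<close> is a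
  proper \<open>M\<close>-colouring of the graph that joins indices at distance less than \<open>\<delta>\<close>.
\<close>

definition colourable :: "nat \<Rightarrow> real \<Rightarrow> (nat \<Rightarrow> complex ^ 'd::finite) \<Rightarrow> bool" where
  "colourable M \<delta> z \<longleftrightarrow> (\<exists>c::nat \<Rightarrow> nat. (\<forall>n. c n < M)
     \<and> (\<forall>j n. j \<noteq> n \<and> pseudo_hyp_dist (z j) (z n) < \<delta> \<longrightarrow> c j \<noteq> c n))"

text \<open>
  Finitely many separated pieces have a common positive separation constant.
\<close>

lemma union_of_separated_iff_colourable:
  assumes "M \<ge> 1"
  shows "union_of_separated M z \<longleftrightarrow> (\<exists>k. colourable M (1 / real (Suc k)) z)"
proof
  assume "union_of_separated M z"
  then obtain I where I: "(\<Union>k<M. I k) = UNIV" "\<forall>k<M. separated_on z (I k)"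
    by (auto simp: union_of_separated_def)
  from I(2) obtain d where d: "\<And>k. k < M \<Longrightarrow> d k > 0"
    "\<And>k n j. k < M \<Longrightarrow> n \<in> I k \<Longrightarrow> j \<in> I k \<Longrightarrow> n \<noteq> j \<Longrightarrow> pseudo_hyp_dist (z n) (z j) \<ge> d k"
    unfolding separated_on_iff by metis
  have "\<forall>n. \<exists>k<M. n \<in> I k" using I(1) by blast
  then obtain c where c: "\<And>n. c n < M" "\<And>n. n \<in> I (c n)" by metis
  have "{..<M} \<noteq> {}" using assms by (auto simp: lessThan_empty_iff)
  then have "0 < Min (d ` {..<M})" using d(1) assms by (subst Min_gr_iff) auto
  then obtain k where k: "1 / real (Suc k) < Min (d ` {..<M})"
    using reals_Archimedean by (auto simp: inverse_eq_divide)
  have "c j \<noteq> c n" if "j \<noteq> n" "pseudo_hyp_dist (z j) (z n) < 1 / real (Suc k)" for j n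
  proof
    assume eq: "c j = c n"
    have "1 / real (Suc k) < d (c n)" using k c(1)[of n] assms by (subst (asm) Min_gr_iff) auto
    also have "\<dots> \<le> pseudo_hyp_dist (z j) (z n)"
      using c[of n] c(2)[of j] eq that by (intro d) auto
    finally show False using that by simp
  qed
  then show "\<exists>k. colourable M (1 / real (Suc k)) z"
    using c unfolding colourable_def by blast
next
  assume "\<exists>k. colourable M (1 / real (Suc k)) z"
  then obtain k c where c: "\<And>n. c n < M"
    "\<And>j n. j \<noteq> n \<Longrightarrow> pseudo_hyp_dist (z j) (z n) < 1 / real (Suc k) \<Longrightarrow> c j \<noteq> c n"
    unfolding colourable_def by blast
  have "separated_on z {n. c n = l}" for l
    unfolding separated_on_iff using c(2) by (intro exI[of _ "1 / real (Suc k)"]) (force simp: not_less[symmetric])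
  then show "union_of_separated M z"
    unfolding union_of_separated_def using c(1)
    by (intro exI[of _ "\<lambda>l. {n. c n = l}"]) (auto simp: disjoint_family_on_def)
qed

lemma colourable_iff_finite:
  "colourable M \<delta> z \<longleftrightarrow> (\<forall>N. \<exists>c\<in>PiE {..<N} (\<lambda>_. {..<M}). \<forall>j\<in>{..<N}. \<forall>n\<in>{..<N}.
     j \<noteq> n \<and> pseudo_hyp_dist (z j) (z n) < \<delta> \<longrightarrow> c j \<noteq> c n)" (is "_ \<longleftrightarrow> ?R")
proof
  assume "colourable M \<delta> z"
  then obtain c where c: "\<And>n. c n < M"
    "\<And>j n. j \<noteq> n \<Longrightarrow> pseudo_hyp_dist (z j) (z n) < \<delta> \<Longrightarrow> c j \<noteq> c n"
    unfolding colourable_def by blast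
  show ?R
  proof
    fix N
    show "\<exists>c\<in>PiE {..<N} (\<lambda>_. {..<M}). \<forall>j\<in>{..<N}. \<forall>n\<in>{..<N}.
       j \<noteq> n \<and> pseudo_hyp_dist (z j) (z n) < \<delta> \<longrightarrow> c j \<noteq> c n"
      using c by (intro bexI[of _ "restrict c {..<N}"]) auto
  qed
next
  assume R: ?R
  show "colourable M \<delta> z"
    unfolding colourable_def
  proof (rule colouring_compactness)
    fix N
    from R obtain c where "c \<in> PiE {..<N} (\<lambda>_. {..<M})" "\<forall>j\<in>{..<N}. \<forall>n\<in>{..<N}.
       j \<noteq> n \<and> pseudo_hyp_dist (z j) (z n) < \<delta> \<longrightarrow> c j \<noteq> c n" by blast
    then show "\<exists>c. (\<forall>n<N. c n < M) \<and> (\<forall>j<N. \<forall>n<N. j \<noteq> n \<and> pseudo_hyp_dist (z j) (z n) < \<delta> \<longrightarrow> c j \<noteq> c n)"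
      by (intro exI[of _ c]) (auto simp: PiE_iff)
  qed
qed

section \<open>Independent uniform angles\<close>

locale random_torus_points = prob_space P for P :: "'w measure" +
  fixes r :: "nat \<Rightarrow> real ^ 'd::finite" and \<theta> :: "nat \<Rightarrow> 'w \<Rightarrow> real ^ 'd"
  assumes radii: "\<And>n i. 0 < r n $ i \<and> r n $ i < 1"
    and indep: "indep_vars (\<lambda>_. borel) \<theta> UNIV"
    and uniform: "\<And>n. distr P borel (\<theta> n) = uniform_measure lborel torus_cube"
begin

lemma angle_measurable [measurable]: "\<theta> n \<in> borel_measurable P"
  using indep by (auto simp: indep_vars_def)

lemma prob_angle:
  assumes "A \<in> sets borel"
  shows "prob {\<omega>\<in>space P. \<theta> n \<omega> \<in> A} = measure (uniform_measure lborel torus_cube) A"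
  unfolding uniform[of n, symmetric] using assms
  by (subst measure_distr) (auto intro!: arg_cong[where f=prob])

lemma prob_angles:
  assumes "finite J" "\<And>j. j \<in> J \<Longrightarrow> A j \<in> sets borel"
  shows "prob {\<omega>\<in>space P. \<forall>j\<in>J. \<theta> j \<omega> \<in> A j}
    = (\<Prod>j\<in>J. measure (uniform_measure lborel torus_cube) (A j))"
proof (cases "J = {}")
  case True
  then show ?thesis by (simp add: prob_space)
next
  case False
  have "prob (\<Inter>j\<in>J. \<theta> j -` A j \<inter> space P) = (\<Prod>j\<in>J. prob (\<theta> j -` A j \<inter> space P))"
    using indep_vars_subset[OF indep, of J] assms False by (intro indep_varsD[where M'="\<lambda>_. borel"]) auto
  moreover have "(\<Inter>j\<in>J. \<theta> j -` A j \<inter> space P) = {\<omega>\<in>space P. \<forall>j\<in>J. \<theta> j \<omega> \<in> A j}"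
    using False by auto
  moreover have "\<theta> j -` A j \<inter> space P = {\<omega>\<in>space P. \<theta> j \<omega> \<in> A j}" for j by auto
  ultimately show ?thesis using assms(2) by (simp add: prob_angle)
qed

lemma AE_angles_in_cube: "AE \<omega> in P. \<forall>n. \<theta> n \<omega> \<in> torus_cube"
proof (subst AE_all_countable, intro allI)
  fix n
  have "prob {\<omega>\<in>space P. \<theta> n \<omega> \<in> torus_cube} = 1"
    by (subst prob_angle) (auto simp: measure_def emeasure_lborel_torus_cube)
  from prob_Collect_eq_1[THEN iffD1, OF _ this] show "AE \<omega> in P. \<theta> n \<omega> \<in> torus_cube" by simp
qed

lemma dist_measurable [measurable]:
  "Measurable.pred P (\<lambda>\<omega>. pseudo_hyp_dist (random_seq r \<theta> \<omega> j) (random_seq r \<theta> \<omega> n) < c)"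
proof -
  have [measurable]: "cis \<in> borel_measurable borel"
    by (intro borel_measurable_continuous_onI continuous_intros)
  have "(\<lambda>x::real^'d. x $ i) \<in> borel_measurable borel" for i
    by (intro borel_measurable_continuous_onI continuous_intros)
  then have [measurable]: "(\<lambda>\<omega>. \<theta> n \<omega> $ i) \<in> borel_measurable P" for n i
    by (rule measurable_compose[OF angle_measurable])
  have [measurable]: "(\<lambda>\<omega>. random_seq r \<theta> \<omega> n $ i) \<in> borel_measurable P" for n i
    unfolding random_seq_def vec_lambda_beta by measurable
  have [measurable]: "(\<lambda>\<omega>. cnj (random_seq r \<theta> \<omega> n $ i)) \<in> borel_measurable P" for n i
    by (rule borel_measurable_continuous_on[of cnj]) (auto intro!: continuous_intros)
  show ?thesis
    unfolding not_le[symmetric] pseudo_hyp_dist_ge_iff by measurable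
qed

text \<open>
  By compactness the event is a countable intersection of finite unions and intersections of events
  in finitely many of the variables.
\<close>

lemma colourable_event [measurable]: "Measurable.pred P (\<lambda>\<omega>. colourable M \<delta> (random_seq r \<theta> \<omega>))"
  unfolding colourable_iff_finite
  by (intro pred_intros_countable pred_intros_finite finite_PiE) measurable

end

section \<open>Convergent sum: crowded points\<close>

lemma weight_le_near:
  fixes m m' :: "nat ^ 'd::finite"
  assumes "m' \<in> near_levels m"
  shows "weight m' \<le> weight m + CARD('d)"
proof -
  have "weight m' \<le> (\<Sum>i\<in>UNIV. m $ i + 1)"
    unfolding weight_def using assms by (intro sum_mono) (auto simp: near_levels_def)
  also have "\<dots> = weight m + CARD('d)" by (simp only: weight_def sum.distrib card_eq_sum)
  finally show ?thesis .
qed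

lemma near_levels_sym: "m' \<in> near_levels m \<longleftrightarrow> m \<in> near_levels m'"
  by (auto simp: near_levels_def)

lemma
  fixes m :: "nat ^ 'd::finite"
  shows finite_near_levels [simp]: "finite (near_levels m)"
    and card_near_levels: "card (near_levels m) \<le> 3 ^ CARD('d)"
proof -
  let ?B = "PiE (UNIV::'d set) (\<lambda>i. {m $ i - 1..m $ i + 1})"
  have sub: "near_levels m \<subseteq> vec_lambda ` ?B"
  proof
    fix m' assume "m' \<in> near_levels m"
    then have "($) m' \<in> ?B" by (auto simp: near_levels_def le_diff_conv)
    moreover have "m' = vec_lambda (($) m')" by (simp add: vec_eq_iff)
    ultimately show "m' \<in> vec_lambda ` ?B" by blast
  qed
  have fin: "finite ?B" by (intro finite_PiE) auto
  then show "finite (near_levels m)" using sub by (meson finite_imageI finite_subset)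
  have "card (near_levels m) \<le> card ?B"
    using sub fin by (meson card_image_le card_mono finite_imageI le_trans)
  also have "\<dots> = (\<Prod>i\<in>UNIV. card {m $ i - 1..m $ i + 1})" by (rule card_PiE) simp
  also have "\<dots> \<le> (\<Prod>i\<in>(UNIV::'d set). 3)" by (intro prod_mono) auto
  finally show "card (near_levels m) \<le> 3 ^ CARD('d)" by simp
qed

text \<open>
  Both factors are at most \<open>3 ^ d\<close> times the largest of the counts on the neighbouring levels, whose
  power is one of the summands on the right.
\<close>

lemma near_sum_bound:
  fixes N :: "nat ^ 'd::finite \<Rightarrow> nat"
  shows "real (N m) * (\<Sum>m'\<in>near_levels m. real (N m')) ^ M
    \<le> 3 ^ (CARD('d) * M) * (\<Sum>m'\<in>near_levels m. real (N m') ^ (1 + M))"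
proof -
  have self: "m \<in> near_levels m" by (simp add: near_levels_def)
  define U where "U = Max (N ` near_levels m)"
  have U: "N m' \<le> U" if "m' \<in> near_levels m" for m'
    using that unfolding U_def by (intro Max_ge) auto
  have "U \<in> N ` near_levels m" unfolding U_def using self by (intro Max_in) auto
  then obtain p where p: "p \<in> near_levels m" "U = N p" by auto
  have "(\<Sum>m'\<in>near_levels m. real (N m')) \<le> real (card (near_levels m)) * real U"
    using U by (intro sum_bounded_above) auto
  also have "\<dots> \<le> 3 ^ CARD('d) * real U"
    using of_nat_mono[OF card_near_levels[of m], where 'a=real] by (intro mult_right_mono) auto
  finally have "real (N m) * (\<Sum>m'\<in>near_levels m. real (N m')) ^ M \<le> real U * (3 ^ CARD('d) * real U) ^ M"
    using U[OF self] by (intro mult_mono power_mono) (auto intro!: sum_nonneg zero_le_power)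
  also have "\<dots> = 3 ^ (CARD('d) * M) * real (N p) ^ (1 + M)"
    by (simp add: p power_mult_distrib power_mult)
  also have "\<dots> \<le> 3 ^ (CARD('d) * M) * (\<Sum>m'\<in>near_levels m. real (N m') ^ (1 + M))"
    using p(1) by (intro mult_left_mono member_le_sum) auto
  finally show ?thesis .
qed

text \<open>
  Each level is adjacent to at most \<open>3 ^ d\<close> others, and adjacent levels have weights differing by at
  most \<open>d\<close>, so summing the counts of adjacent levels loses only a constant.
\<close>

lemma near_sum_total_bound:
  fixes N :: "nat ^ 'd::finite \<Rightarrow> nat"
  assumes bound: "\<And>F. finite F \<Longrightarrow> (\<Sum>m\<in>F. real (N m) ^ (1 + M) / 2 ^ (M * weight m)) \<le> S"
    and F: "finite F"
  shows "(\<Sum>m\<in>F. real (N m) * ((\<Sum>m'\<in>near_levels m. real (N m')) / 2 ^ weight m) ^ M)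
    \<le> 3 ^ (CARD('d) * M) * 2 ^ (CARD('d) * M) * 3 ^ CARD('d) * S"
proof -
  let ?d = "CARD('d)"
  define t where "t m = real (N m) ^ (1 + M) / 2 ^ (M * weight m)" for m
  have t0: "0 \<le> t m" for m by (simp add: t_def)
  define F' where "F' = (\<Union>m\<in>F. near_levels m)"
  have F': "finite F'" using F by (simp add: F'_def)
  have "(\<Sum>m\<in>F. real (N m) * ((\<Sum>m'\<in>near_levels m. real (N m')) / 2 ^ weight m) ^ M)
    \<le> (\<Sum>m\<in>F. \<Sum>m'\<in>near_levels m. 3 ^ (?d * M) * 2 ^ (?d * M) * t m')"
  proof (rule sum_mono)
    fix m
    have "real (N m) * ((\<Sum>m'\<in>near_levels m. real (N m')) / 2 ^ weight m) ^ M
      = (real (N m) * (\<Sum>m'\<in>near_levels m. real (N m')) ^ M) / 2 ^ (M * weight m)"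
      by (simp add: power_divide power_mult[symmetric] mult.commute)
    also have "\<dots> \<le> (3 ^ (?d * M) * (\<Sum>m'\<in>near_levels m. real (N m') ^ (1 + M))) / 2 ^ (M * weight m)"
      by (intro divide_right_mono near_sum_bound) auto
    also have "\<dots> = (\<Sum>m'\<in>near_levels m. 3 ^ (?d * M) * (real (N m') ^ (1 + M) / 2 ^ (M * weight m)))"
      by (simp add: sum_distrib_left sum_divide_distrib)
    also have "\<dots> \<le> (\<Sum>m'\<in>near_levels m. 3 ^ (?d * M) * (2 ^ (?d * M) * t m'))"
    proof (intro sum_mono mult_left_mono)
      fix m' assume "m' \<in> near_levels m"
      then have "M * weight m' \<le> ?d * M + M * weight m"
        using mult_left_mono[OF weight_le_near[of m' m], of M] by (simp add: algebra_simps)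
      then have "(2::real) ^ (M * weight m') \<le> 2 ^ (?d * M + M * weight m)" by (intro power_increasing) auto
      then have "1 / 2 ^ (M * weight m) \<le> 2 ^ (?d * M) * (1 / (2::real) ^ (M * weight m'))"
        by (simp add: field_simps power_add)
      from mult_left_mono[OF this, of "real (N m') ^ (1 + M)"]
      show "real (N m') ^ (1 + M) / 2 ^ (M * weight m) \<le> 2 ^ (?d * M) * t m'"
        by (simp add: t_def mult_ac)
    qed auto
    finally show "real (N m) * ((\<Sum>m'\<in>near_levels m. real (N m')) / 2 ^ weight m) ^ M
      \<le> (\<Sum>m'\<in>near_levels m. 3 ^ (?d * M) * 2 ^ (?d * M) * t m')" by (simp add: mult.assoc)
  qed
  also have "\<dots> = 3 ^ (?d * M) * 2 ^ (?d * M) * (\<Sum>m\<in>F. \<Sum>m'\<in>near_levels m. t m')"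
    by (simp add: sum_distrib_left)
  also have "(\<Sum>m\<in>F. \<Sum>m'\<in>near_levels m. t m') = (\<Sum>m\<in>F. \<Sum>m'\<in>{m'\<in>F'. m' \<in> near_levels m}. t m')"
    by (intro sum.cong) (auto simp: F'_def)
  also have "\<dots> = (\<Sum>m'\<in>F'. \<Sum>m\<in>{m\<in>F. m' \<in> near_levels m}. t m')"
    using F F' by (rule sum.swap_restrict)
  also have "\<dots> \<le> (\<Sum>m'\<in>F'. 3 ^ ?d * t m')"
  proof (rule sum_mono)
    fix m'
    have "card {m\<in>F. m' \<in> near_levels m} \<le> card (near_levels m')"
      by (intro card_mono) (auto simp: near_levels_sym)
    then have "card {m\<in>F. m' \<in> near_levels m} \<le> 3 ^ ?d" using card_near_levels le_trans by blast
    from of_nat_mono[OF this, where 'a=real]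
    have "real (card {m\<in>F. m' \<in> near_levels m}) \<le> 3 ^ ?d" by simp
    then show "(\<Sum>m\<in>{m\<in>F. m' \<in> near_levels m}. t m') \<le> 3 ^ ?d * t m'"
      using t0 by (simp add: mult_right_mono)
  qed
  also have "\<dots> = 3 ^ ?d * (\<Sum>m'\<in>F'. t m')" by (simp add: sum_distrib_left)
  also have "\<dots> \<le> 3 ^ ?d * S"
    using bound[OF F'] unfolding t_def by (intro mult_left_mono) auto
  finally show ?thesis by (simp add: mult.assoc mult_left_mono)
qed

definition near_region :: "nat ^ 'd::finite \<Rightarrow> ('d \<Rightarrow> nat) \<Rightarrow> (real ^ 'd) set" where
  "near_region q b = (\<Union>c\<in>near_cells q b. cell q c)"

lemma near_region_measurable [measurable]: "near_region q b \<in> sets borel"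
  unfolding near_region_def by (intro sets.finite_UN) auto

lemma measure_near_region:
  "measure (uniform_measure lborel torus_cube) (near_region q (b::'d::finite \<Rightarrow> nat))
    \<le> 5 ^ CARD('d) * (1/2) ^ weight q"
proof -
  have "measure (uniform_measure lborel torus_cube) (near_region q b)
    \<le> (\<Sum>c\<in>near_cells q b. measure (uniform_measure lborel torus_cube) (cell q c))"
    unfolding near_region_def by (rule measure_UNION_le) auto
  also have "\<dots> \<le> real (card (near_cells q b)) * (1/2) ^ weight q"
    by (intro sum_bounded_above measure_uniform_cell_le)
  also have "\<dots> \<le> 5 ^ CARD('d) * (1/2) ^ weight q"
    using of_nat_mono[OF card_near_cells[of q b], where 'a=real] by (intro mult_right_mono) auto
  finally show ?thesis .
qed

context random_torus_points
begin

lemma angles_event: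
  assumes "finite J" "\<And>j. j \<in> J \<Longrightarrow> A j \<in> sets borel"
  shows "{\<omega>\<in>space P. \<forall>j\<in>J. \<theta> j \<omega> \<in> A j} \<in> sets P"
proof (rule sets.sets_Collect_finite_All)
  fix j assume "j \<in> J"
  then show "{\<omega>\<in>space P. \<theta> j \<omega> \<in> A j} \<in> sets P"
    using measurable_sets[OF angle_measurable assms(2)] by (simp add: vimage_def Int_def conj_commute)
qed fact

definition near_indices :: "nat \<Rightarrow> nat set" where
  "near_indices n = {j. level (r j) \<in> near_levels (level (r n))}"

text \<open>
  The candidate sets of \<open>M\<close> companions of the point with index \<open>n\<close>.
\<close>

definition crowds :: "nat \<Rightarrow> nat \<Rightarrow> nat set set" where
  "crowds M n = {J. J \<subseteq> near_indices n - {n} \<and> card J = M}"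

definition crowd_event :: "nat \<Rightarrow> nat set \<Rightarrow> ('d \<Rightarrow> nat) \<Rightarrow> 'w set" where
  "crowd_event n J b = {\<omega>\<in>space P. \<forall>j\<in>insert n J.
     \<theta> j \<omega> \<in> (if j = n then cell (level (r n)) b else near_region (level (r n)) b)}"

text \<open>
  For angles in the unit cube this holds whenever the point \<open>n\<close> has \<open>M\<close> others within distance
  \<open>1/17\<close>.  It is phrased with cells, so that independence of the angles applies to it without conditioning.
\<close>

definition crowded :: "nat \<Rightarrow> nat \<Rightarrow> 'w set" where
  "crowded M n = (\<Union>J\<in>crowds M n. \<Union>b\<in>cells (level (r n)). crowd_event n J b)"

lemma finite_crowds: "finite (near_indices n) \<Longrightarrow> finite (crowds M n)"
  by (rule finite_subset[of _ "Pow (near_indices n)"]) (auto simp: crowds_def)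

lemma crowd_event_measurable: "finite J \<Longrightarrow> crowd_event n J b \<in> sets P"
  unfolding crowd_event_def by (intro angles_event) auto

lemma finite_crowd: "finite (near_indices n) \<Longrightarrow> J \<in> crowds M n \<Longrightarrow> finite J"
  by (auto simp: crowds_def intro: finite_subset)

lemma crowded_measurable:
  assumes "finite (near_indices n)"
  shows "crowded M n \<in> sets P"
  unfolding crowded_def
proof (intro sets.finite_UN finite_cells)
  show "finite (crowds M n)" using assms by (rule finite_crowds)
  show "crowd_event n J b \<in> sets P" if "J \<in> crowds M n" for J b
    using finite_crowd[OF assms that] by (rule crowd_event_measurable)
qed

text \<open>
  Union bound over the \<open>2 ^ |q|\<close> cells for the point \<open>n\<close> and over its companions: the sum over the cells
  cancels the probability of the cell of \<open>n\<close>, and each companion contributes a factor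
  \<open>5 ^ d * 2 ^ - |q|\<close>.
\<close>

lemma prob_crowded_le:
  assumes fin: "finite (near_indices n)"
  shows "prob (crowded M n)
    \<le> (5 ^ CARD('d) * real (card (near_indices n)) / 2 ^ weight (level (r n))) ^ M"
proof -
  let ?q = "level (r n)" and ?T = "near_indices n"
  note fJ = finite_crowds[OF fin, of M] and finJ = finite_crowd[OF fin, of _ M]
  have "prob (crowded M n) \<le> (\<Sum>J\<in>crowds M n. prob (\<Union>b\<in>cells ?q. crowd_event n J b))"
    unfolding crowded_def using fJ finJ by (intro measure_UNION_le sets.finite_UN crowd_event_measurable) auto
  also have "\<dots> \<le> (\<Sum>J\<in>crowds M n. \<Sum>b\<in>cells ?q. prob (crowd_event n J b))"
    using finJ by (intro sum_mono measure_UNION_le crowd_event_measurable) auto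
  also have "\<dots> \<le> (\<Sum>J\<in>crowds M n. \<Sum>b\<in>cells ?q. (1/2) ^ weight ?q * (5 ^ CARD('d) * (1/2) ^ weight ?q) ^ M)"
  proof (intro sum_mono)
    fix J b assume J: "J \<in> crowds M n"
    then have n: "n \<notin> J" and c: "card J = M" by (auto simp: crowds_def)
    let ?m = "measure (uniform_measure lborel torus_cube) :: (real^'d) set \<Rightarrow> real"
    have "prob (crowd_event n J b) = (\<Prod>j\<in>insert n J. ?m (if j = n then cell ?q b else near_region ?q b))"
      unfolding crowd_event_def using finJ[OF J] by (intro prob_angles) auto
    also have "\<dots> = ?m (cell ?q b) * (\<Prod>j\<in>J. ?m (if j = n then cell ?q b else near_region ?q b))"
      using finJ[OF J] n by simp
    also have "(\<Prod>j\<in>J. ?m (if j = n then cell ?q b else near_region ?q b)) = ?m (near_region ?q b) ^ M"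
      unfolding c[symmetric] using n by (subst prod_constant[symmetric]) (intro prod.cong, auto)
    also have "?m (cell ?q b) * ?m (near_region ?q b) ^ M \<le> (1/2) ^ weight ?q * (5 ^ CARD('d) * (1/2) ^ weight ?q) ^ M"
      by (intro mult_mono power_mono measure_uniform_cell_le measure_near_region) auto
    finally show "prob (crowd_event n J b) \<le> (1/2) ^ weight ?q * (5 ^ CARD('d) * (1/2) ^ weight ?q) ^ M" .
  qed
  also have "\<dots> = real (card (crowds M n)) * (5 ^ CARD('d) * (1/2) ^ weight ?q) ^ M"
    by (simp add: card_cells power_one_over)
  also have "\<dots> \<le> real (card ?T) ^ M * (5 ^ CARD('d) * (1/2) ^ weight ?q) ^ M"
  proof (rule mult_right_mono)
    have "card (crowds M n) \<le> card {J. J \<subseteq> ?T \<and> card J = M}"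
      using fin by (intro card_mono) (auto simp: crowds_def)
    also have "\<dots> = card ?T choose M" using fin by (rule n_subsets)
    also have "\<dots> \<le> card ?T ^ M"
      by (cases "M \<le> card ?T") (auto simp: binomial_le_pow binomial_eq_0)
    finally show "real (card (crowds M n)) \<le> real (card ?T) ^ M" by (metis of_nat_mono of_nat_power)
  qed simp
  also have "\<dots> = (5 ^ CARD('d) * real (card ?T) / 2 ^ weight ?q) ^ M"
    by (simp add: power_mult_distrib power_divide power_one_over mult_ac)
  finally show ?thesis .
qed

lemma near_imp_in_near_region:
  assumes cube: "\<And>n. \<theta> n \<omega> \<in> torus_cube"
    and near: "pseudo_hyp_dist (random_seq r \<theta> \<omega> n) (random_seq r \<theta> \<omega> j) < 1/17"
    and b: "\<theta> n \<omega> \<in> cell (level (r n)) b"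
  shows "j \<in> near_indices n" "\<theta> j \<omega> \<in> near_region (level (r n)) b"
  using near_imp_near_level_and_cell[of "r n" "r j" "\<theta> n \<omega>" "\<theta> j \<omega>" b] assms radii
  by (auto simp: near_indices_def near_region_def random_seq_eq)

lemma near_imp_near_index:
  assumes cube: "\<And>n. \<theta> n \<omega> \<in> torus_cube"
    and near: "pseudo_hyp_dist (random_seq r \<theta> \<omega> n) (random_seq r \<theta> \<omega> j) < 1/17"
  shows "j \<in> near_indices n"
proof -
  obtain b where "\<theta> n \<omega> \<in> cell (level (r n)) b" using torus_cube_in_cell[OF cube] by blast
  then show ?thesis using near_imp_in_near_region(1)[OF assms] by blast
qed

lemma many_near_imp_crowded:
  assumes \<omega>: "\<omega> \<in> space P" and cube: "\<And>n. \<theta> n \<omega> \<in> torus_cube"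
    and card: "M \<le> card {j. j \<noteq> n \<and> pseudo_hyp_dist (random_seq r \<theta> \<omega> n) (random_seq r \<theta> \<omega> j) < 1/17}"
  shows "\<omega> \<in> crowded M n"
proof -
  let ?A = "{j. j \<noteq> n \<and> pseudo_hyp_dist (random_seq r \<theta> \<omega> n) (random_seq r \<theta> \<omega> j) < 1/17}"
  obtain b where b: "b \<in> cells (level (r n))" "\<theta> n \<omega> \<in> cell (level (r n)) b"
    using torus_cube_in_cell[OF cube] by blast
  obtain J where J: "J \<subseteq> ?A" "card J = M" using obtain_subset_with_card_n[OF card] by metis
  show ?thesis
    unfolding crowded_def crowd_event_def using J b \<omega> near_imp_in_near_region[OF cube _ b(2)]
    by (intro UN_I[of J] UN_I[of b]) (auto simp: crowds_def)
qed

text \<open>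
  Two independent uniform angles share a cell of side \<open>2 ^ - k\<close> with probability at most \<open>2 ^ - k\<close>.
\<close>

lemma AE_angles_distinct: "j \<noteq> n \<Longrightarrow> AE \<omega> in P. \<theta> j \<omega> \<noteq> \<theta> n \<omega>"
proof -
  assume jn: "j \<noteq> n"
  define q :: "nat \<Rightarrow> nat ^ 'd" where "q k = (\<chi> i. k)" for k
  let ?Z = "\<lambda>k. \<Union>b\<in>cells (q k). {\<omega>\<in>space P. \<forall>i\<in>{j, n}. \<theta> i \<omega> \<in> cell (q k) b}"
  have Z [measurable]: "?Z k \<in> sets P" for k
    by (intro sets.finite_UN finite_cells angles_event) auto
  have le: "prob (\<Inter>k. ?Z k) \<le> (1/2) ^ k" for k
  proof -
    have "prob (\<Inter>k. ?Z k) \<le> prob (?Z k)" using Z by (intro finite_measure_mono) auto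
    also have "\<dots> \<le> (\<Sum>b\<in>cells (q k). prob {\<omega>\<in>space P. \<forall>i\<in>{j, n}. \<theta> i \<omega> \<in> cell (q k) b})"
      by (intro measure_UNION_le finite_cells angles_event) auto
    also have "\<dots> = (\<Sum>b\<in>cells (q k). (1/2) ^ weight (q k) * (1/2) ^ weight (q k))"
      using jn by (intro sum.cong refl, subst prob_angles) (auto simp: measure_uniform_cell)
    also have "\<dots> = (1/2) ^ weight (q k)"
      by (simp add: card_cells power_one_over)
    also have "\<dots> \<le> (1/2) ^ k"
      by (intro power_decreasing) (auto simp: weight_def q_def Suc_le_eq)
    finally show ?thesis .
  qed
  have "(\<lambda>k. (1/2::real) ^ k) \<longlonglongrightarrow> 0" by (intro LIMSEQ_power_zero) auto
  then have "prob (\<Inter>k. ?Z k) \<le> 0" using le by (intro LIMSEQ_le_const) auto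
  then have "prob (\<Inter>k. ?Z k) = 0" using measure_le_0_iff by blast
  moreover have "(\<Inter>k. ?Z k) \<in> sets P" using Z by (intro sets.countable_INT) auto
  ultimately have "AE \<omega> in P. \<omega> \<notin> (\<Inter>k. ?Z k)"
    using prob_eq_0 by blast
  with AE_angles_in_cube AE_space show ?thesis
  proof eventually_elim
    case (elim \<omega>)
    show ?case
    proof
      assume eq: "\<theta> j \<omega> = \<theta> n \<omega>"
      have "\<omega> \<in> ?Z k" for k
      proof -
        obtain b where "b \<in> cells (q k)" "\<theta> j \<omega> \<in> cell (q k) b"
          using torus_cube_in_cell elim(1) by metis
        then show ?thesis using eq elim by auto
      qed
      then show False using elim by blast
    qed
  qed
qed

lemma torus_point_neqI:
  fixes x y s t :: "real ^ 'd"
  assumes x: "\<And>i. 0 < x $ i" and y: "\<And>i. 0 < y $ i"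
    and s: "s \<in> torus_cube" and t: "t \<in> torus_cube" and st: "s \<noteq> t"
  shows "torus_point x s \<noteq> torus_point y t"
proof
  assume eq: "torus_point x s = torus_point y t"
  obtain i where i: "s $ i \<noteq> t $ i" using st by (auto simp: vec_eq_iff)
  have *: "complex_of_real (x $ i) * cis (2 * pi * s $ i) = complex_of_real (y $ i) * cis (2 * pi * t $ i)"
    using arg_cong[OF eq, of "\<lambda>v. v $ i"] by (simp add: torus_point_def)
  then have "norm (complex_of_real (x $ i) * cis (2 * pi * s $ i)) = norm (complex_of_real (y $ i) * cis (2 * pi * t $ i))"
    by simp
  then have "x $ i = y $ i" using x[of i] y[of i] by (simp add: norm_mult)
  then have "cis (2 * pi * s $ i) = cis (2 * pi * t $ i)" using * x[of i] by simp
  then have "min \<bar>s $ i - t $ i\<bar> (1 - \<bar>s $ i - t $ i\<bar>) \<le> 0"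
    using circle_dist_le_norm_cis_diff[of "s $ i" "t $ i"] s t by (simp add: torus_cube_def)
  moreover have "0 \<le> s $ i" "s $ i < 1" "0 \<le> t $ i" "t $ i < 1" using s t by (auto simp: torus_cube_def)
  ultimately show False using i by linarith
qed

lemma torus_point_in_polydisc:
  fixes x t :: "real ^ 'd"
  shows "(\<And>i. 0 < x $ i \<and> x $ i < 1) \<Longrightarrow> torus_point x t \<in> polydisc"
  by (simp add: polydisc_def torus_point_def norm_mult abs_of_pos)

text \<open>
  The first Borel--Cantelli lemma.  Grouping the indices by level turns the sum of the probabilities
  into \<open>\<Sum>m. N m * (\<Sum>m' near m. N m' / 2 ^ |m|) ^ M\<close>, which is dominated by the given sum.
\<close>

lemma AE_finitely_many_crowded:
  assumes fin: "\<And>m. finite {n. level (r n) = m}"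
    and bound: "\<And>F. finite F \<Longrightarrow> (\<Sum>m\<in>F. real (card {n. level (r n) = m}) ^ (1 + M) / 2 ^ (M * weight m)) \<le> S"
  shows "AE \<omega> in P. finite {n. \<omega> \<in> crowded M n}"
proof -
  let ?N = "\<lambda>m. card {n. level (r n) = m}"
  define c :: real where "c = (5 ^ CARD('d)) ^ M"
  define g where "g m = ((\<Sum>m'\<in>near_levels m. real (?N m')) / 2 ^ weight m) ^ M" for m
  have near_eq: "near_indices n = (\<Union>m\<in>near_levels (level (r n)). {j. level (r j) = m})" for n
    by (auto simp: near_indices_def)
  have finT: "finite (near_indices n)" for n unfolding near_eq using fin by simp
  have cardT: "real (card (near_indices n)) = (\<Sum>m'\<in>near_levels (level (r n)). real (?N m'))" for n
    unfolding near_eq using fin by (subst card_UN_disjoint) auto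
  have p: "prob (crowded M n) \<le> c * g (level (r n))" for n
    using prob_crowded_le[OF finT, of M n]
    by (simp add: cardT c_def g_def power_mult_distrib power_divide)
  have partial: "(\<Sum>n<K. prob (crowded M n))
    \<le> c * (3 ^ (CARD('d) * M) * 2 ^ (CARD('d) * M) * 3 ^ CARD('d) * S)" for K
  proof -
    have "(\<Sum>n<K. prob (crowded M n)) \<le> (\<Sum>n<K. c * g (level (r n)))"
      by (intro sum_mono p)
    also have "\<dots> = c * (\<Sum>n<K. g (level (r n)))" by (simp add: sum_distrib_left)
    also have "(\<Sum>n<K. g (level (r n)))
      = (\<Sum>m\<in>(\<lambda>n. level (r n)) ` {..<K}. \<Sum>n\<in>{n\<in>{..<K}. level (r n) = m}. g (level (r n)))"
      by (rule sum.image_gen) simp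
    also have "\<dots> \<le> (\<Sum>m\<in>(\<lambda>n. level (r n)) ` {..<K}. real (?N m) * g m)"
    proof (rule sum_mono)
      fix m
      have "(\<Sum>n\<in>{n\<in>{..<K}. level (r n) = m}. g (level (r n))) = real (card {n\<in>{..<K}. level (r n) = m}) * g m"
        by simp
      also have "\<dots> \<le> real (?N m) * g m"
        using fin[of m] by (intro mult_right_mono of_nat_mono card_mono) (auto simp: g_def intro!: zero_le_power divide_nonneg_nonneg sum_nonneg)
      finally show "(\<Sum>n\<in>{n\<in>{..<K}. level (r n) = m}. g (level (r n))) \<le> real (?N m) * g m" .
    qed
    also have "\<dots> \<le> 3 ^ (CARD('d) * M) * 2 ^ (CARD('d) * M) * 3 ^ CARD('d) * S"
      unfolding g_def by (rule near_sum_total_bound[OF bound]) auto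
    finally show ?thesis by (simp add: c_def mult_left_mono)
  qed
  have "summable (\<lambda>n. prob (crowded M n))"
    using partial by (intro summableI_nonneg_bounded) auto
  moreover have "crowded M n \<in> sets P" for n
    using crowded_measurable[OF finT] by simp
  ultimately have "AE \<omega> in P. \<forall>\<^sub>F n in sequentially. \<omega> \<in> space P - crowded M n"
    by (intro borel_cantelli_AE1) (auto simp: emeasure_eq_measure)
  then show ?thesis
  proof (eventually_elim)
    case (elim \<omega>)
    then have "\<forall>\<^sub>F n in cofinite. \<omega> \<notin> crowded M n"
      by (auto simp: cofinite_eq_sequentially elim!: eventually_mono)
    then show ?case by (simp add: eventually_cofinite)
  qed
qed

text \<open>
  Almost surely all points are distinct and only finitely many are crowded; each of these has finitely
  many points near it.  Below the smallest of the finitely many distances involved, the crowded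
  points have no neighbour at all and the others have fewer than \<open>M\<close>, so the greedy colouring applies.
\<close>

lemma AE_colourable_if_sum_bounded:
  assumes M: "M \<ge> 1"
    and fin: "\<And>m. finite {n. level (r n) = m}"
    and bound: "\<And>F. finite F \<Longrightarrow> (\<Sum>m\<in>F. real (card {n. level (r n) = m}) ^ (1 + M) / 2 ^ (M * weight m)) \<le> S"
  shows "AE \<omega> in P. \<exists>k. colourable M (1 / real (Suc k)) (random_seq r \<theta> \<omega>)"
proof -
  have finT: "finite (near_indices n)" for n
  proof -
    have "near_indices n = (\<Union>m\<in>near_levels (level (r n)). {j. level (r j) = m})"
      by (auto simp: near_indices_def)
    then show ?thesis using fin by simp
  qed
  have "AE \<omega> in P. \<forall>j n. j \<noteq> n \<longrightarrow> \<theta> j \<omega> \<noteq> \<theta> n \<omega>"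
    using AE_angles_distinct by (simp add: AE_all_countable)
  moreover have "AE \<omega> in P. finite {n. \<omega> \<in> crowded M n}"
    by (rule AE_finitely_many_crowded[OF fin bound])
  ultimately show ?thesis
    using AE_space AE_angles_in_cube
  proof eventually_elim
    case (elim \<omega>)
    let ?\<rho> = "\<lambda>n j. pseudo_hyp_dist (random_seq r \<theta> \<omega> n) (random_seq r \<theta> \<omega> j)"
    define F where "F = {n. \<omega> \<in> crowded M n}"
    \<comment> \<open>The entry \<open>1/17\<close> keeps the final separation constant below the threshold that defines closeness.\<close>
    define D where "D = insert (1/17) ((\<lambda>(n, j). ?\<rho> n j) ` (SIGMA n:F. near_indices n - {n}))"
    have cube: "\<And>n. \<theta> n \<omega> \<in> torus_cube" using elim by blast
    have finD: "finite D" unfolding D_def using elim finT by (auto simp: F_def)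
    have pos: "0 < ?\<rho> n j" if "n \<noteq> j" for n j
      unfolding random_seq_eq using that elim radii
      by (intro pseudo_hyp_dist_pos torus_point_in_polydisc torus_point_neqI) auto
    then have "0 < Min D" using finD by (subst Min_gr_iff) (auto simp: D_def)
    then obtain k where k: "1 / real (Suc k) < Min D"
      using reals_Archimedean by (auto simp: inverse_eq_divide)
    then have kD: "1 / real (Suc k) < x" if "x \<in> D" for x
      using that finD Min_le less_le_trans by blast
    define E where "E j n \<longleftrightarrow> j \<noteq> n \<and> ?\<rho> j n < 1 / real (Suc k)" for j n
    have close: "?\<rho> j n < 1/17" if "E j n" for j n
    proof -
      have "1 / real (Suc k) < 1/17" by (rule kD) (simp add: D_def)
      then show ?thesis using that unfolding E_def by linarith
    qed
    have "card {j. j < n \<and> E j n} < M" for n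
    proof (cases "n \<in> F")
      case True
      have "\<not> E j n" if "j < n" for j
      proof
        assume E: "E j n"
        then have "?\<rho> n j < 1/17" using close pseudo_hyp_dist_sym by metis
        then have "j \<in> near_indices n"
          by (rule near_imp_near_index[OF cube])
        then have "?\<rho> n j \<in> D" using True that unfolding D_def by (auto intro!: image_eqI[of _ _ "(n, j)"])
        then show False using kD E pseudo_hyp_dist_sym unfolding E_def by (metis less_asym)
      qed
      then have empty: "{j. j < n \<and> E j n} = {}" by blast
      show ?thesis unfolding empty using M by simp
    next
      case False
      let ?A = "{j. j \<noteq> n \<and> ?\<rho> n j < 1/17}"
      have "?A \<subseteq> near_indices n"
        using near_imp_near_index[OF cube] by blast
      then have "finite ?A" using finT finite_subset by blast
      moreover have "{j. j < n \<and> E j n} \<subseteq> ?A"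
        using close by (auto simp: E_def pseudo_hyp_dist_sym[of "random_seq r \<theta> \<omega> n"])
      ultimately have "card {j. j < n \<and> E j n} \<le> card ?A" by (intro card_mono)
      moreover have "card ?A < M"
        using False many_near_imp_crowded[OF \<open>\<omega> \<in> space P\<close> cube, of M n] by (auto simp: F_def not_le[symmetric])
      ultimately show ?thesis by simp
    qed
    then have "\<exists>c::nat \<Rightarrow> nat. (\<forall>n. c n < M) \<and> (\<forall>j n. E j n \<longrightarrow> c j \<noteq> c n)"
      by (intro greedy_colouring) (auto simp: E_def pseudo_hyp_dist_sym)
    then show ?case unfolding colourable_def E_def by blast
  qed
qed

end

section \<open>Probability of a full cell\<close>

text \<open>
  The second Bonferroni inequality, with the intersections summed over ordered pairs.
\<close>

lemma (in finite_measure) bonferroni_lower: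
  assumes "finite I" "\<And>i. i \<in> I \<Longrightarrow> A i \<in> sets M"
  shows "(\<Sum>i\<in>I. measure M (A i)) \<le> measure M (\<Union>i\<in>I. A i) + (\<Sum>i\<in>I. \<Sum>j\<in>I - {i}. measure M (A i \<inter> A j))"
  using assms
proof (induction I rule: finite_induct)
  case empty
  then show ?case by simp
next
  case (insert x F)
  let ?U = "\<Union>i\<in>F. A i"
  have U: "?U \<in> sets M" and x: "A x \<in> sets M" using insert by auto
  have un: "measure M (A x \<union> ?U) = measure M (A x) + measure M ?U - measure M (A x \<inter> ?U)"
    using U x by (intro measure_Un3) (auto simp: fmeasurable_eq_sets)
  have "measure M (A x \<inter> ?U) = measure M (\<Union>j\<in>F. A x \<inter> A j)" by (simp only: Int_UN_distrib)
  also have "\<dots> \<le> (\<Sum>j\<in>F. measure M (A x \<inter> A j))"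
    using insert by (intro measure_UNION_le) auto
  finally have le: "measure M (A x \<inter> ?U) \<le> (\<Sum>j\<in>F. measure M (A x \<inter> A j))" .
  have "insert x F - {x} = F" using insert by auto
  moreover have "(\<Sum>i\<in>F. \<Sum>j\<in>F - {i}. measure M (A i \<inter> A j)) \<le> (\<Sum>i\<in>F. \<Sum>j\<in>insert x F - {i}. measure M (A i \<inter> A j))"
    using insert by (intro sum_mono sum_mono2) auto
  ultimately show ?case using insert un le by simp
qed

lemma (in finite_measure) measure_disjoint_sum_le:
  assumes "finite I" "\<And>i. i \<in> I \<Longrightarrow> A i \<in> sets M" "disjoint_family_on A I" "(\<Union>i\<in>I. A i) \<subseteq> B" "B \<in> sets M"
  shows "(\<Sum>i\<in>I. measure M (A i)) \<le> measure M B"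
proof -
  have "(\<Sum>i\<in>I. measure M (A i)) = measure M (\<Union>i\<in>I. A i)"
    using assms by (intro finite_measure_finite_Union[symmetric]) auto
  also have "\<dots> \<le> measure M B" using assms by (intro finite_measure_mono)
  finally show ?thesis .
qed

lemma binomial_Suc_le:
  assumes "k < n"
  shows "(Suc n choose Suc k) \<le> (k + 2) * (n choose Suc k)"
proof -
  obtain b where n: "n = Suc (k + b)" using assms less_iff_Suc_add by auto
  have "(n choose k) \<le> Suc b * (n choose k)" by simp
  also have "\<dots> = Suc k * (n choose Suc k)" unfolding n by (rule Suc_times_binomial_add[symmetric])
  finally show ?thesis by simp
qed

text \<open>
  The Bonferroni bound for \<open>n\<close> points in \<open>B\<close> cells is useful only while the expected number
  \<open>(n choose (M + 1)) / B ^ M\<close> of \<open>(M + 1)\<close>-sets sharing a cell is small.  If there are too many points, discard some: passing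
  from \<open>n\<close> to \<open>n + 1\<close> multiplies this number by at most \<open>M + 2\<close>, so the largest admissible \<open>n\<close> keeps it
  above a constant.
\<close>

lemma group_size_exists:
  fixes B :: real
  assumes M: "M \<ge> 1" and B: "(2 * real M + 2) ^ (M + 1) \<le> B" and n0: "M < n0"
  shows "\<exists>n. M < n \<and> n \<le> n0 \<and> real n \<le> B / 2 \<and> real (n choose (M + 1)) / B ^ M \<le> 1/4
    \<and> 1 / (4 * (real M + 2) ^ (M + 1)) * min 1 (real n0 ^ (M + 1) / B ^ M) \<le> real (n choose (M + 1)) / B ^ M"
proof -
  define c where "c = 1 / (4 * (real M + 2) ^ (M + 1))"
  have c0: "0 < c" by (simp add: c_def)
  have "(4::real) \<le> (2 * real M + 2) ^ 1" using M by simp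
  also have "\<dots> \<le> (2 * real M + 2) ^ (M + 1)" by (intro power_increasing) auto
  finally have B4: "4 \<le> B" using B by simp
  then have BM: "4 \<le> B ^ M" using power_increasing[of 1 M B] M by simp
  have ge: "(real n / real (M + 1)) ^ (M + 1) \<le> real (n choose (M + 1))" if "M < n" for n
    using binomial_ge_n_over_k_pow_k[of "M + 1" n, where 'a=real] that by simp
  have half: "real n \<le> B / 2" if n: "M < n" and x: "real (n choose (M + 1)) / B ^ M \<le> 1/4" for n
  proof (rule ccontr)
    assume "\<not> real n \<le> B / 2"
    then have "B / 2 / real (M + 1) \<le> real n / real (M + 1)" by (intro divide_right_mono) auto
    moreover have "B / 2 / real (M + 1) = B / (2 * real M + 2)" by (simp add: algebra_simps)
    ultimately have "B / (2 * real M + 2) \<le> real n / real (M + 1)" by linarith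
    then have "(B / (2 * real M + 2)) ^ (M + 1) \<le> (real n / real (M + 1)) ^ (M + 1)"
      using B4 by (intro power_mono) auto
    also have "\<dots> \<le> real (n choose (M + 1))" by (rule ge[OF n])
    also have "\<dots> \<le> B ^ M / 4" using x BM by (simp add: pos_divide_le_eq)
    finally have "B ^ (M + 1) / (2 * real M + 2) ^ (M + 1) \<le> B ^ M / 4"
      by (simp only: power_divide)
    moreover have "0 < (2 * real M + 2) ^ (M + 1)" by simp
    ultimately have "B ^ (M + 1) * 4 \<le> B ^ M * (2 * real M + 2) ^ (M + 1)"
      by (simp only: divide_le_eq pos_le_divide_eq zero_less_numeral times_divide_eq_left split: if_splits)
    also have "\<dots> \<le> B ^ M * B" using B BM by (intro mult_left_mono) auto
    finally show False using B4 BM by simp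
  qed
  have c1: "c * (real n0 ^ (M + 1) / B ^ M) \<le> (real n0 / real (M + 1)) ^ (M + 1) / B ^ M"
  proof -
    have "real (M + 1) ^ (M + 1) \<le> 4 * (real M + 2) ^ (M + 1)"
    proof -
      have "real (M + 1) ^ (M + 1) \<le> (real M + 2) ^ (M + 1)" by (rule power_mono) auto
      moreover have "0 \<le> (real M + 2) ^ (M + 1)" by (rule zero_le_power) simp
      ultimately show ?thesis by linarith
    qed
    then have "c \<le> 1 / real (M + 1) ^ (M + 1)" unfolding c_def by (intro divide_left_mono) auto
    then have "c * real n0 ^ (M + 1) \<le> 1 / real (M + 1) ^ (M + 1) * real n0 ^ (M + 1)"
      by (intro mult_right_mono) auto
    also have "\<dots> = (real n0 / real (M + 1)) ^ (M + 1)" by (simp only: power_divide) simp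
    finally have "c * real n0 ^ (M + 1) / B ^ M \<le> (real n0 / real (M + 1)) ^ (M + 1) / B ^ M"
      by (rule divide_right_mono) (use BM in linarith)
    then show ?thesis by (simp only: times_divide_eq_right)
  qed
  show ?thesis
    unfolding c_def[symmetric]
  proof (cases "real (n0 choose (M + 1)) / B ^ M \<le> 1/4")
    case True
    have "c * min 1 (real n0 ^ (M + 1) / B ^ M) \<le> c * (real n0 ^ (M + 1) / B ^ M)"
      using c0 by (intro mult_left_mono) auto
    also have "\<dots> \<le> real (n0 choose (M + 1)) / B ^ M"
      using c1 ge[OF n0] BM by (meson divide_right_mono order_trans zero_le_numeral)
    finally show "\<exists>n. M < n \<and> n \<le> n0 \<and> real n \<le> B / 2 \<and> real (n choose (M + 1)) / B ^ M \<le> 1/4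
      \<and> c * min 1 (real n0 ^ (M + 1) / B ^ M) \<le> real (n choose (M + 1)) / B ^ M"
      using True n0 half[OF n0 True] by (intro exI[of _ n0]) auto
  next
    case False
    define S where "S = {n. M < n \<and> n \<le> n0 \<and> real (n choose (M + 1)) / B ^ M \<le> 1/4}"
    have "M + 1 \<in> S" using n0 BM by (simp add: S_def)
    moreover have "finite S" by (rule finite_subset[of _ "{..n0}"]) (auto simp: S_def)
    ultimately have max: "Max S \<in> S" "\<And>n. n \<in> S \<Longrightarrow> n \<le> Max S" using Max_in by auto
    define n where "n = Max S"
    have n: "M < n" "n \<le> n0" "real (n choose (M + 1)) / B ^ M \<le> 1/4"
      using max(1) by (auto simp: S_def n_def)
    have "n \<noteq> n0" using n False by auto
    then have "Suc n \<le> n0" using n by simp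
    moreover have "Suc n \<notin> S" using max(2)[of "Suc n"] by (auto simp: n_def)
    ultimately have "1/4 < real (Suc n choose (M + 1)) / B ^ M" using n by (auto simp: S_def)
    also have "\<dots> \<le> (real M + 2) * (real (n choose (M + 1)) / B ^ M)"
    proof -
      have "real (Suc n choose (M + 1)) \<le> (real M + 2) * real (n choose (M + 1))"
        using of_nat_mono[OF binomial_Suc_le[OF n(1)], where 'a=real]
        by (simp only: of_nat_mult of_nat_add of_nat_numeral Suc_eq_plus1)
      then have "real (Suc n choose (M + 1)) / B ^ M \<le> (real M + 2) * real (n choose (M + 1)) / B ^ M"
        by (rule divide_right_mono) (use BM in linarith)
      then show ?thesis by (simp only: times_divide_eq_right)
    qed
    finally have lower: "1 / (4 * (real M + 2)) \<le> real (n choose (M + 1)) / B ^ M"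
      by (simp add: field_simps)
    have "c * min 1 (real n0 ^ (M + 1) / B ^ M) \<le> c * 1" using c0 by (intro mult_left_mono) auto
    also have "\<dots> \<le> 1 / (4 * (real M + 2))"
    proof -
      have "(real M + 2) ^ 1 \<le> (real M + 2) ^ (M + 1)" by (rule power_increasing) auto
      then have "4 * (real M + 2) \<le> 4 * (real M + 2) ^ (M + 1)" unfolding power_one_right by (rule mult_left_mono) simp
      then show ?thesis unfolding c_def mult_1_right by (rule divide_left_mono) auto
    qed
    finally show "\<exists>n. M < n \<and> n \<le> n0 \<and> real n \<le> B / 2 \<and> real (n choose (M + 1)) / B ^ M \<le> 1/4
      \<and> c * min 1 (real n0 ^ (M + 1) / B ^ M) \<le> real (n choose (M + 1)) / B ^ M"
      using n lower half[OF n(1,3)] by (intro exI[of _ n]) auto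
  qed
qed

context random_torus_points
begin

text \<open>
  The cell \<open>b\<close> contains at least \<open>M + 1\<close> of the angles with index in \<open>K\<close>.
\<close>

definition full_cell_event :: "nat \<Rightarrow> nat set \<Rightarrow> nat ^ 'd \<Rightarrow> ('d \<Rightarrow> nat) \<Rightarrow> 'w set" where
  "full_cell_event M K q b = (\<Union>T\<in>{T. T \<subseteq> K \<and> card T = M + 1}. {\<omega>\<in>space P. \<forall>j\<in>T. \<theta> j \<omega> \<in> cell q b})"

lemma finite_group_subsets: "finite K \<Longrightarrow> finite {T. T \<subseteq> K \<and> card T = k}"
  by (rule finite_subset[of _ "Pow K"]) auto

lemma full_cell_event_measurable:
  assumes "finite K"
  shows "full_cell_event M K q b \<in> sets P"
  unfolding full_cell_event_def
proof (intro sets.finite_UN finite_group_subsets assms)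
  fix T assume "T \<in> {T. T \<subseteq> K \<and> card T = M + 1}"
  then show "{\<omega>\<in>space P. \<forall>j\<in>T. \<theta> j \<omega> \<in> cell q b} \<in> sets P"
    using assms by (intro angles_event) (auto intro: finite_subset)
qed

lemma measure_uniform_compl_cell:
  fixes q :: "nat ^ 'd"
  assumes "b \<in> cells q"
  shows "measure (uniform_measure lborel torus_cube) (- cell q b) = 1 - (1/2) ^ weight q"
proof -
  interpret U: prob_space "uniform_measure lborel torus_cube :: (real^'d) measure"
    unfolding uniform[of 0, symmetric] by (rule prob_space_distr) simp
  have "U.prob (space (uniform_measure lborel torus_cube) - cell q b) = 1 - U.prob (cell q b)"
    by (rule U.prob_compl) simp
  then show ?thesis by (simp add: measure_uniform_cell[OF assms] Compl_eq_Diff_UNIV)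
qed

text \<open>
  The events that exactly the indices of a given \<open>(M + 1)\<close>-set fall into the cell are disjoint.
\<close>

lemma prob_full_cell_ge:
  assumes K: "finite K" and b: "b \<in> cells q"
  shows "real (card K choose (M + 1)) * ((1/2) ^ weight q) ^ (M + 1) * (1 - (1/2) ^ weight q) ^ (card K - (M + 1))
    \<le> prob (full_cell_event M K q b)"
proof -
  let ?p = "(1/2::real) ^ weight q" and ?C = "cell q b"
  let ?\<T> = "{T. T \<subseteq> K \<and> card T = M + 1}"
  let ?X = "\<lambda>T. {\<omega>\<in>space P. \<forall>j\<in>K. \<theta> j \<omega> \<in> (if j \<in> T then ?C else - ?C)}"
  have X: "?X T \<in> sets P" for T using K by (intro angles_event) auto
  have pX: "prob (?X T) = ?p ^ (M + 1) * (1 - ?p) ^ (card K - (M + 1))" if T: "T \<in> ?\<T>" for T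
  proof -
    let ?m = "measure (uniform_measure lborel torus_cube) :: (real^'d) set \<Rightarrow> real"
    have fT: "finite T" using T K finite_subset by auto
    have cK: "card (K - T) = card K - (M + 1)"
      using T card_Diff_subset[OF fT, of K] by simp
    have "prob (?X T) = (\<Prod>j\<in>K. ?m (if j \<in> T then ?C else - ?C))"
      using K by (intro prob_angles) auto
    also have "\<dots> = (\<Prod>j\<in>K. if j \<in> T then ?p else 1 - ?p)"
      using b by (intro prod.cong refl) (auto simp: measure_uniform_cell measure_uniform_compl_cell)
    also have "\<dots> = (\<Prod>j\<in>T. ?p) * (\<Prod>j\<in>K - T. 1 - ?p)"
    proof -
      have "K \<inter> {j. j \<in> T} = T" "K \<inter> - {j. j \<in> T} = K - T" using T by auto
      then show ?thesis using K by (subst prod.If_cases) auto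
    qed
    also have "\<dots> = ?p ^ (M + 1) * (1 - ?p) ^ (card K - (M + 1))"
      using T by (simp only: prod_constant cK) auto
    finally show ?thesis .
  qed
  have disj: "disjoint_family_on ?X ?\<T>"
    unfolding disjoint_family_on_def
  proof (intro ballI impI)
    fix T T' assume T: "T \<in> ?\<T>" "T' \<in> ?\<T>" "T \<noteq> T'"
    then obtain j where "j \<in> K" "j \<in> T \<longleftrightarrow> j \<notin> T'" by blast
    then show "?X T \<inter> ?X T' = {}" by (auto split: if_splits)
  qed
  have "real (card ?\<T>) * (?p ^ (M + 1) * (1 - ?p) ^ (card K - (M + 1))) = (\<Sum>T\<in>?\<T>. prob (?X T))"
    using pX by simp
  also have "\<dots> \<le> prob (full_cell_event M K q b)"
  proof (rule measure_disjoint_sum_le[OF finite_group_subsets[OF K] X disj _ full_cell_event_measurable[OF K]])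
    show "(\<Union>T\<in>?\<T>. ?X T) \<subseteq> full_cell_event M K q b"
      unfolding full_cell_event_def by (intro UN_mono) auto
  qed
  finally show ?thesis using n_subsets[OF K, of "M + 1"] by (simp add: mult.assoc)
qed

text \<open>
  The \<open>(M + 1)\<close>-sets that fill two different cells are disjoint, so their events are independent; a
  union bound over pairs of sets remains.
\<close>

lemma prob_two_full_cells_le:
  assumes K: "finite K" and b: "b \<in> cells q" "b' \<in> cells q" and neq: "b \<noteq> b'"
  shows "prob (full_cell_event M K q b \<inter> full_cell_event M K q b')
    \<le> (real (card K choose (M + 1)) * ((1/2) ^ weight q) ^ (M + 1))\<^sup>2"
proof -
  let ?p = "(1/2::real) ^ weight q"
  let ?\<T> = "{T. T \<subseteq> K \<and> card T = M + 1}"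
  let ?Y = "\<lambda>T b. {\<omega>\<in>space P. \<forall>j\<in>T. \<theta> j \<omega> \<in> cell q b}"
  have f\<T>: "finite ?\<T>" using K by (rule finite_group_subsets)
  have fT: "finite T" if "T \<in> ?\<T>" for T using that K finite_subset by auto
  have Y: "?Y T b \<in> sets P" if "T \<in> ?\<T>" for T b using fT[OF that] by (intro angles_event) auto
  have pY: "prob (?Y T b \<inter> ?Y T' b') \<le> (?p ^ (M + 1))\<^sup>2" if T: "T \<in> ?\<T>" "T' \<in> ?\<T>" for T T'
  proof (cases "T \<inter> T' = {}")
    case False
    then obtain j where "j \<in> T" "j \<in> T'" by auto
    then have "?Y T b \<inter> ?Y T' b' = {}" using neq cell_unique by blast
    then show ?thesis by simp
  next
    case True
    have both: "?Y T b \<inter> ?Y T' b' = {\<omega>\<in>space P. \<forall>j\<in>T \<union> T'. \<theta> j \<omega> \<in> (if j \<in> T then cell q b else cell q b')}"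
      using True by auto
    have "prob (?Y T b \<inter> ?Y T' b')
      = (\<Prod>j\<in>T \<union> T'. measure (uniform_measure lborel torus_cube) (if j \<in> T then cell q b else cell q b'))"
      unfolding both using fT T by (intro prob_angles) auto
    also have "\<dots> = (\<Prod>j\<in>T \<union> T'. ?p)"
      using b by (intro prod.cong refl) (auto simp: measure_uniform_cell)
    also have "\<dots> = ?p ^ (card T + card T')"
      using card_Un_disjoint[OF fT[OF T(1)] fT[OF T(2)] True] by (simp only: prod_constant)
    also have "\<dots> = (?p ^ (M + 1))\<^sup>2"
      using T by (simp only: power2_eq_square power_add mem_Collect_eq)
    finally show ?thesis by simp
  qed
  have both: "full_cell_event M K q b \<inter> full_cell_event M K q b' = (\<Union>T\<in>?\<T>. \<Union>T'\<in>?\<T>. ?Y T b \<inter> ?Y T' b')"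
    unfolding full_cell_event_def by blast
  have "prob (full_cell_event M K q b \<inter> full_cell_event M K q b')
    \<le> (\<Sum>T\<in>?\<T>. prob (\<Union>T'\<in>?\<T>. ?Y T b \<inter> ?Y T' b'))"
    unfolding both by (intro measure_UNION_le f\<T> sets.finite_UN sets.Int Y)
  also have "\<dots> \<le> (\<Sum>T\<in>?\<T>. \<Sum>T'\<in>?\<T>. prob (?Y T b \<inter> ?Y T' b'))"
    by (intro sum_mono measure_UNION_le f\<T> sets.Int Y)
  also have "\<dots> \<le> (\<Sum>T\<in>?\<T>. \<Sum>T'\<in>?\<T>. (?p ^ (M + 1))\<^sup>2)" by (intro sum_mono pY)
  also have "\<dots> = (real (card K choose (M + 1)) * ?p ^ (M + 1))\<^sup>2"
    using n_subsets[OF K, of "M + 1"] by (simp add: power2_eq_square)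
  finally show ?thesis .
qed

definition full_event :: "nat \<Rightarrow> nat set \<Rightarrow> nat ^ 'd \<Rightarrow> 'w set" where
  "full_event M K q = (\<Union>b\<in>cells q. full_cell_event M K q b)"

lemma full_event_measurable: "finite K \<Longrightarrow> full_event M K q \<in> sets P"
  unfolding full_event_def by (intro sets.finite_UN finite_cells full_cell_event_measurable)

text \<open>
  With \<open>x\<close> the quantity on the left before division by \<open>4\<close>, the single terms of Bonferroni add up to at
  least \<open>x / 2\<close> by Bernoulli's inequality, and the pairs subtract at most \<open>x\<^sup>2 \<le> x / 4\<close>.
\<close>

lemma prob_full_event_ge:
  assumes K: "finite K" and half: "real (card K) \<le> 2 ^ weight q / 2"
    and small: "real (card K choose (M + 1)) / (2 ^ weight q) ^ M \<le> 1/4"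
  shows "real (card K choose (M + 1)) / (2 ^ weight q) ^ M / 4 \<le> prob (full_event M K q)"
proof -
  let ?B = "(2::real) ^ weight q" and ?p = "(1/2::real) ^ weight q"
  define a where "a = real (card K choose (M + 1)) * ?p ^ (M + 1)"
  have a0: "0 \<le> a" by (simp add: a_def)
  have p: "?p = 1 / ?B" by (simp add: power_one_over)
  have x: "?B * a = real (card K choose (M + 1)) / ?B ^ M" by (simp add: a_def p power_one_over)
  have p1: "?p \<le> 1" by (simp add: power_le_one)
  have "1/2 \<le> (1 - ?p) ^ (card K - (M + 1))"
  proof -
    have "1/2 \<le> 1 + real (card K - (M + 1)) * (- ?p)"
    proof -
      have "real (card K - (M + 1)) * ?p \<le> ?B / 2 * ?p" using half by (intro mult_right_mono) auto
      also have "\<dots> = 1/2" by (simp add: p)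
      finally show ?thesis by simp
    qed
    also have "\<dots> \<le> (1 + (- ?p)) ^ (card K - (M + 1))"
      using p1 by (intro Bernoulli_inequality) auto
    finally show ?thesis by simp
  qed
  then have one: "a / 2 \<le> prob (full_cell_event M K q b)" if "b \<in> cells q" for b
  proof -
    have "a * (1/2) \<le> a * (1 - ?p) ^ (card K - (M + 1))"
      using \<open>1/2 \<le> _\<close> a0 by (rule mult_left_mono)
    also have "\<dots> \<le> prob (full_cell_event M K q b)"
      using prob_full_cell_ge[OF K that, of M] by (simp add: a_def)
    finally show ?thesis by simp
  qed
  have "?B * (a / 2) = (\<Sum>b\<in>cells q. a / 2)" by (simp add: card_cells)
  also have "\<dots> \<le> (\<Sum>b\<in>cells q. prob (full_cell_event M K q b))" by (intro sum_mono one)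
  also have "\<dots> \<le> prob (full_event M K q)
      + (\<Sum>b\<in>cells q. \<Sum>b'\<in>cells q - {b}. prob (full_cell_event M K q b \<inter> full_cell_event M K q b'))"
    unfolding full_event_def using K by (intro bonferroni_lower full_cell_event_measurable) auto
  also have "(\<Sum>b\<in>cells q. \<Sum>b'\<in>cells q - {b}. prob (full_cell_event M K q b \<inter> full_cell_event M K q b'))
    \<le> (\<Sum>b\<in>cells q. \<Sum>b'\<in>cells q - {b}. a\<^sup>2)"
    unfolding a_def using K by (intro sum_mono prob_two_full_cells_le) auto
  also have "\<dots> \<le> (\<Sum>b\<in>cells q. \<Sum>b'\<in>cells q. a\<^sup>2)"
    by (intro sum_mono sum_mono2) auto
  also have "\<dots> = (?B * a)\<^sup>2" by (simp add: card_cells power2_eq_square)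
  also have "\<dots> \<le> ?B * a * (1/4)"
    using small a0 unfolding x[symmetric] power2_eq_square by (intro mult_left_mono) auto
  finally have "?B * a / 4 \<le> prob (full_event M K q)" by linarith
  then show ?thesis by (simp add: x)
qed

end

section \<open>Divergent sum: full cells\<close>

text \<open>
  The sum is dominated by a product of \<open>d\<close> geometric series.
\<close>

lemma sum_half_weight_le:
  fixes F :: "(nat ^ 'd::finite) set"
  assumes "finite F" "M \<ge> 1"
  shows "(\<Sum>m\<in>F. 1 / 2 ^ (M * weight m)) \<le> (2::real) ^ CARD('d)"
proof -
  define k where "k = Suc (\<Sum>m\<in>F. weight m)"
  have lt: "m $ i < k" if "m \<in> F" for m i
  proof -
    have "m $ i \<le> weight m" unfolding weight_def by (rule member_le_sum) auto
    also have "\<dots> \<le> (\<Sum>m\<in>F. weight m)" using that assms by (intro member_le_sum) auto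
    finally show ?thesis by (simp add: k_def)
  qed
  have inj: "inj_on ($) F" by (auto simp: inj_on_def vec_eq_iff)
  have "(\<Sum>m\<in>F. 1 / (2::real) ^ (M * weight m)) \<le> (\<Sum>m\<in>F. \<Prod>i\<in>UNIV. (1/2) ^ (m $ i))"
  proof (rule sum_mono)
    fix m :: "nat ^ 'd"
    have "1 / (2::real) ^ (M * weight m) = (1/2) ^ (M * weight m)" by (simp add: power_one_over)
    also have "\<dots> \<le> (1/2) ^ weight m" using assms(2) by (intro power_decreasing) auto
    also have "\<dots> = (\<Prod>i\<in>UNIV. (1/2) ^ (m $ i))" by (simp add: weight_def power_sum)
    finally show "1 / (2::real) ^ (M * weight m) \<le> (\<Prod>i\<in>UNIV. (1/2) ^ (m $ i))" .
  qed
  also have "\<dots> = (\<Sum>f\<in>($) ` F. \<Prod>i\<in>UNIV. (1/2) ^ f i)"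
    using inj by (simp add: sum.reindex)
  also have "\<dots> \<le> (\<Sum>f\<in>PiE (UNIV::'d set) (\<lambda>_. {..<k}). \<Prod>i\<in>UNIV. (1/2) ^ f i)"
    using lt by (intro sum_mono2 finite_PiE) (auto intro!: prod_nonneg)
  also have "\<dots> = (\<Prod>i\<in>(UNIV::'d set). \<Sum>j<k. (1/2) ^ j)"
    by (rule prod_sum_PiE[symmetric]) auto
  also have "\<dots> \<le> (\<Prod>i\<in>(UNIV::'d set). 2)"
  proof (intro prod_mono conjI sum_nonneg)
    show "(\<Sum>j<k. (1/2::real) ^ j) \<le> 2" by (simp add: sum_gp_strict)
  qed auto
  finally show ?thesis by simp
qed

text \<open>
  Divergence survives when the terms are cut off at \<open>1\<close> and the levels with at most \<open>R\<close> points are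
  dropped: the latter contribute a convergent sum, and infinitely many terms above \<open>1\<close> already give
  divergence.  Sparse levels must be dropped because too few points cannot fill a cell.
\<close>

lemma truncated_sum_unbounded:
  fixes N :: "nat ^ 'd::finite \<Rightarrow> nat" and R M :: nat
  defines "t \<equiv> \<lambda>m. real (N m) ^ (1 + M) / 2 ^ (M * weight m)"
  assumes M: "M \<ge> 1" and unbounded: "\<And>S. \<exists>F. finite F \<and> S < (\<Sum>m\<in>F. t m)"
  shows "\<exists>F. finite F \<and> F \<subseteq> {m. R < N m} \<and> A \<le> (\<Sum>m\<in>F. min 1 (t m))"
proof (rule ccontr)
  assume "\<not> ?thesis"
  then have lt: "(\<Sum>m\<in>F. min 1 (t m)) < A" if "finite F" "F \<subseteq> {m. R < N m}" for F
    using that not_le by blast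
  have t0: "0 \<le> t m" for m by (simp add: t_def)
  define G where "G = {m. R < N m \<and> 1 \<le> t m}"
  have "finite G"
  proof (rule ccontr)
    assume "infinite G"
    then obtain H where H: "finite H" "H \<subseteq> G" "card H = nat \<lceil>A\<rceil>"
      using infinite_arbitrarily_large by metis
    have "A \<le> (\<Sum>m\<in>H. 1)" using H(3) by simp linarith
    also have "\<dots> \<le> (\<Sum>m\<in>H. min 1 (t m))" using H(2) by (intro sum_mono) (auto simp: G_def)
    also have "\<dots> < A" using H by (intro lt) (auto simp: G_def)
    finally show False by simp
  qed
  \<comment> \<open>The bound on the left is the total of the three parts of the sum estimated below.\<close>
  obtain F where F: "finite F" "real R ^ (1 + M) * 2 ^ CARD('d) + A + (\<Sum>m\<in>G. t m) < (\<Sum>m\<in>F. t m)"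
    using unbounded by blast
  let ?F1 = "{m\<in>F. N m \<le> R}" and ?F2 = "{m\<in>F. R < N m \<and> t m < 1}" and ?F3 = "{m\<in>F. R < N m \<and> 1 \<le> t m}"
  have "(\<Sum>m\<in>F. t m) = (\<Sum>m\<in>?F1 \<union> (?F2 \<union> ?F3). t m)" by (intro sum.cong) auto
  also have "\<dots> = (\<Sum>m\<in>?F1. t m) + ((\<Sum>m\<in>?F2. t m) + (\<Sum>m\<in>?F3. t m))"
    using F(1) by (subst sum.union_disjoint, simp, simp, force, subst sum.union_disjoint) auto
  also have "(\<Sum>m\<in>?F1. t m) \<le> (\<Sum>m\<in>?F1. real R ^ (1 + M) * (1 / 2 ^ (M * weight m)))"
    unfolding t_def using power_mono[of "real (N _)" "real R" "1 + M"]
    by (intro sum_mono) (auto intro!: divide_right_mono)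
  also have "\<dots> \<le> real R ^ (1 + M) * 2 ^ CARD('d)"
    unfolding sum_distrib_left[symmetric] using F(1) M by (intro mult_left_mono sum_half_weight_le) auto
  also have "(\<Sum>m\<in>?F2. t m) = (\<Sum>m\<in>?F2. min 1 (t m))" by (intro sum.cong) auto
  also have "\<dots> < A" using F(1) by (intro lt) auto
  also have "(\<Sum>m\<in>?F3. t m) \<le> (\<Sum>m\<in>G. t m)"
    using \<open>finite G\<close> t0 by (intro sum_mono2) (auto simp: G_def)
  finally show False using F(2) by simp
qed

lemma not_colourable_if_crowd:
  assumes "finite T" "card T = M + 1"
    and close: "\<And>j n. j \<in> T \<Longrightarrow> n \<in> T \<Longrightarrow> j \<noteq> n \<Longrightarrow> pseudo_hyp_dist (z j) (z n) < \<delta>"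
  shows "\<not> colourable M \<delta> z"
proof
  assume "colourable M \<delta> z"
  then obtain c :: "nat \<Rightarrow> nat" where c: "\<And>n. c n < M"
    "\<And>j n. j \<noteq> n \<Longrightarrow> pseudo_hyp_dist (z j) (z n) < \<delta> \<Longrightarrow> c j \<noteq> c n"
    unfolding colourable_def by blast
  have "inj_on c T" using c(2) close by (meson inj_onI)
  then have "card T \<le> card {..<M}" using c(1) by (intro card_inj_on_le) auto
  then show False using assms by simp
qed

lemma pigeonhole_fibre:
  assumes "finite X" "finite C" "f ` X \<subseteq> C" "R * card C < card X"
  shows "\<exists>c\<in>C. R < card {x\<in>X. f x = c} \<and> card X \<le> card C * card {x\<in>X. f x = c}"
proof -
  have "C \<noteq> {}" using assms by auto
  let ?g = "\<lambda>c. card {x\<in>X. f x = c}"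
  define g where "g = Max (?g ` C)"
  have "g \<in> ?g ` C" unfolding g_def using assms \<open>C \<noteq> {}\<close> by (intro Max_in) auto
  then obtain c where c: "c \<in> C" "g = ?g c" by auto
  have "card X = (\<Sum>c\<in>C. ?g c)"
    using sum.group[OF assms(1,2,3), of "\<lambda>_. 1::nat"] by simp
  also have "\<dots> \<le> card C * g"
    using sum_bounded_above[of C ?g g] assms(2) by (simp add: g_def)
  finally have "card X \<le> card C * g" .
  moreover have "R * card C < g * card C" using less_le_trans[OF assms(4) calculation] by (simp only: mult.commute)
  then have "R < g" by simp
  ultimately show ?thesis using c by auto
qed

text \<open>
  Cells of side \<open>2 ^ - (m $ i + L)\<close> have hyperbolic size of order \<open>2 ^ - L\<close> at level \<open>m\<close>.
\<close>

definition refine :: "nat \<Rightarrow> nat ^ 'd::finite \<Rightarrow> nat ^ 'd" where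
  "refine L m = (\<chi> i. m $ i + L)"

lemma weight_refine: "weight (refine L (m :: nat ^ 'd::finite)) = weight m + CARD('d) * L"
  by (simp add: weight_def refine_def sum.distrib)

text \<open>
  The radii of one level, cut into boundedly many intervals of relative length \<open>2 ^ - L\<close>.
\<close>

definition radial_class :: "nat \<Rightarrow> real ^ 'd::finite \<Rightarrow> 'd \<Rightarrow> nat" where
  "radial_class L x = (\<lambda>i. nat \<lfloor>(1 - x $ i) * 2 ^ (level x $ i + 1 + L)\<rfloor>)"

definition radial_classes :: "nat \<Rightarrow> ('d::finite \<Rightarrow> nat) set" where
  "radial_classes L = PiE UNIV (\<lambda>_. {..<2 ^ (L + 1)})"

lemma finite_radial_classes [simp]: "finite (radial_classes L)"
  unfolding radial_classes_def by (intro finite_PiE) auto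

lemma card_radial_classes: "card (radial_classes L :: ('d::finite \<Rightarrow> nat) set) = 2 ^ ((L + 1) * CARD('d))"
  unfolding radial_classes_def by (subst card_PiE) (simp_all only: card_lessThan prod_constant power_mult finite)

lemma radial_class_in:
  assumes "\<And>i. 0 < x $ i \<and> x $ i < 1"
  shows "radial_class L x \<in> radial_classes L"
proof -
  have "radial_class L x i < 2 ^ (L + 1)" for i
  proof -
    have "1 - x $ i < (1/2) ^ (level x $ i)"
      using assms ring_index_bounds(2)[of "x $ i"] by (simp add: level_def)
    then have "(1 - x $ i) * 2 ^ (level x $ i + 1 + L) < (1/2) ^ (level x $ i) * 2 ^ (level x $ i + 1 + L)"
      by (intro mult_strict_right_mono) auto
    also have "\<dots> = 2 ^ (L + 1)" by (simp add: power_add power_one_over)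
    finally have "\<lfloor>(1 - x $ i) * 2 ^ (level x $ i + 1 + L)\<rfloor> < 2 ^ (L + 1)" by (simp add: floor_less_iff)
    moreover have "0 \<le> (1 - x $ i) * 2 ^ (level x $ i + 1 + L)" using assms[of i] by simp
    ultimately show ?thesis unfolding radial_class_def by (simp add: nat_less_iff)
  qed
  then show ?thesis by (auto simp: radial_classes_def)
qed

lemma abs_diff_le_if_same_floor:
  fixes u v :: real
  assumes "0 \<le> u" "0 \<le> v" "nat \<lfloor>u\<rfloor> = nat \<lfloor>v\<rfloor>"
  shows "\<bar>u - v\<bar> \<le> 1"
proof -
  have "\<lfloor>u\<rfloor> = \<lfloor>v\<rfloor>" using assms by (simp add: eq_nat_nat_iff)
  then show ?thesis by linarith
qed

text \<open>
  Both the radial and the angular difference are of order \<open>2 ^ - L\<close> relative to the distance to the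
  boundary.
\<close>

lemma same_cell_imp_close:
  fixes x y s t :: "real ^ 'd::finite"
  assumes x: "\<And>i. 0 < x $ i \<and> x $ i < 1" and y: "\<And>i. 0 < y $ i \<and> y $ i < 1"
    and lev: "level x = level y" and rad: "radial_class L x = radial_class L y"
    and s: "s \<in> cell (refine L (level x)) b" and t: "t \<in> cell (refine L (level x)) b"
    and \<delta>: "32 / 2 ^ L < \<delta>"
  shows "pseudo_hyp_dist (torus_point x s) (torus_point y t) < \<delta>"
proof -
  have "norm ((torus_point x s $ i - torus_point y t $ i) / (1 - cnj (torus_point y t $ i) * torus_point x s $ i))
    \<le> 32 / 2 ^ L" for i
  proof (rule pseudo_hyp_le)
    let ?k = "level x $ i"
    have norms: "norm (torus_point x s $ i) = x $ i" "norm (torus_point y t $ i) = y $ i"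
      using x[of i] y[of i] by (auto simp: torus_point_def norm_mult)
    show "norm (torus_point x s $ i) < 1" "norm (torus_point y t $ i) \<le> 1"
      using norms x[of i] y[of i] by auto
    have "\<bar>(1 - x $ i) * 2 ^ (?k + 1 + L) - (1 - y $ i) * 2 ^ (?k + 1 + L)\<bar> \<le> 1"
      using x[of i] y[of i] fun_cong[OF rad, of i] lev
      by (intro abs_diff_le_if_same_floor) (auto simp: radial_class_def)
    moreover have "(1 - x $ i) * 2 ^ (?k + 1 + L) - (1 - y $ i) * 2 ^ (?k + 1 + L) = (y $ i - x $ i) * 2 ^ (?k + 1 + L)"
      by (simp add: algebra_simps)
    ultimately have "\<bar>x $ i - y $ i\<bar> * 2 ^ (?k + 1 + L) \<le> 1"
      by (simp add: abs_mult abs_minus_commute)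
    then have rad_le: "\<bar>x $ i - y $ i\<bar> \<le> 1 / 2 ^ (?k + 1 + L)" by (simp add: field_simps)
    have "\<bar>2 ^ (?k + L) * s $ i - 2 ^ (?k + L) * t $ i\<bar> \<le> 1"
    proof -
      have "real (b i) \<le> 2 ^ (?k + L) * s $ i" "2 ^ (?k + L) * s $ i < real (b i) + 1"
        "real (b i) \<le> 2 ^ (?k + L) * t $ i" "2 ^ (?k + L) * t $ i < real (b i) + 1"
        using s t by (auto simp: cell_def refine_def)
      then show ?thesis by linarith
    qed
    then have "2 ^ (?k + L) * \<bar>s $ i - t $ i\<bar> \<le> 1"
      by (simp add: abs_mult flip: right_diff_distrib)
    then have ang_le: "\<bar>s $ i - t $ i\<bar> \<le> 1 / 2 ^ (?k + L)" by (simp add: field_simps)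
    have "norm (torus_point x s $ i - torus_point y t $ i) \<le> \<bar>x $ i - y $ i\<bar> + 2 * pi * \<bar>s $ i - t $ i\<bar>"
      using norm_polar_diff_le[of "x $ i" "y $ i" "s $ i" "t $ i"] x[of i] y[of i] by (simp add: torus_point_def)
    also have "\<dots> \<le> 1 / 2 ^ (?k + 1 + L) + 2 * 4 * (1 / 2 ^ (?k + L))"
      using rad_le ang_le pi_less_4 by (intro add_mono mult_mono) auto
    \<comment> \<open>The left side is \<open>17 / 2 ^ (?k + 1 + L)\<close>.\<close>
    also have "\<dots> \<le> 32 / 2 ^ L * (1/2) ^ (?k + 1)"
      by (simp add: power_add power_one_over field_simps)
    also have "\<dots> \<le> 32 / 2 ^ L * (1 - x $ i)"
      using x[of i] ring_index_bounds(1)[of "x $ i"] by (intro mult_left_mono) (auto simp: level_def)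
    finally show "norm (torus_point x s $ i - torus_point y t $ i) \<le> 32 / 2 ^ L * (1 - norm (torus_point x s $ i))"
      by (simp add: norms)
  qed
  then show ?thesis
    using \<delta> pseudo_hyp_dist_ge_iff[of \<delta> "torus_point x s" "torus_point y t"] by (meson not_le order_trans)
qed

context random_torus_points
begin

text \<open>
  Among \<open>M + 1\<close> mutually close points two have the same colour.
\<close>

lemma full_event_not_colourable:
  assumes K: "finite K" "\<And>n. n \<in> K \<Longrightarrow> level (r n) = m \<and> radial_class L (r n) = \<kappa>"
    and \<omega>: "\<omega> \<in> full_event M K (refine L m)" and \<delta>: "32 / 2 ^ L < \<delta>"
  shows "\<not> colourable M \<delta> (random_seq r \<theta> \<omega>)"
proof -
  obtain b T where T: "T \<subseteq> K" "card T = M + 1" "\<forall>j\<in>T. \<theta> j \<omega> \<in> cell (refine L m) b"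
    using \<omega> by (auto simp: full_event_def full_cell_event_def)
  show ?thesis
  proof (rule not_colourable_if_crowd[OF _ T(2)])
    show "finite T" using T K finite_subset by blast
    fix j n assume jn: "j \<in> T" "n \<in> T"
    then have "j \<in> K" "n \<in> K" using T by auto
    then show "pseudo_hyp_dist (random_seq r \<theta> \<omega> j) (random_seq r \<theta> \<omega> n) < \<delta>"
      unfolding random_seq_eq using K(2)[of j] K(2)[of n] T(3) jn \<delta> radii
      by (intro same_cell_imp_close[where L=L and b=b]) auto
  qed
qed

text \<open>
  Infinitely many points of one level lie in finitely many combinations of radial class and cell, so
  one combination contains \<open>M + 1\<close> of them.
\<close>

lemma AE_not_colourable_if_infinite_level:
  assumes inf: "infinite {n. level (r n) = m}" and \<delta>: "0 < \<delta>"
  shows "AE \<omega> in P. \<not> colourable M \<delta> (random_seq r \<theta> \<omega>)"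
proof -
  obtain L where "32 / \<delta> < (2::real) ^ L" using real_arch_pow[of 2] by auto
  then have L: "32 / 2 ^ L < \<delta>" using \<delta> by (simp add: field_simps)
  from AE_angles_in_cube AE_space show ?thesis
  proof eventually_elim
    case (elim \<omega>)
    let ?q = "refine L m"
    have "\<forall>n. \<exists>b. b \<in> cells ?q \<and> \<theta> n \<omega> \<in> cell ?q b"
      using elim torus_cube_in_cell by metis
    then obtain b where b: "\<And>n. b n \<in> cells ?q" "\<And>n. \<theta> n \<omega> \<in> cell ?q (b n)" by metis
    let ?f = "\<lambda>n. (radial_class L (r n), b n)"
    have "finite (?f ` {n. level (r n) = m})"
      by (rule finite_subset[of _ "radial_classes L \<times> cells ?q"])
        (use b radial_class_in[OF radii] in auto)
    from pigeonhole_infinite[OF inf this] obtain n0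
      where "infinite {n \<in> {n. level (r n) = m}. ?f n = ?f n0}" by blast
    from infinite_arbitrarily_large[OF this, of "M + 1"] obtain K
      where K: "K \<subseteq> {n \<in> {n. level (r n) = m}. ?f n = ?f n0}" "finite K" "card K = M + 1" by blast
    have "\<omega> \<in> full_event M K ?q"
      unfolding full_event_def full_cell_event_def
    proof (intro UN_I)
      show "b n0 \<in> cells ?q" by (rule b)
      show "K \<in> {T. T \<subseteq> K \<and> card T = M + 1}" using K by simp
      have "\<theta> j \<omega> \<in> cell ?q (b n0)" if "j \<in> K" for j
      proof -
        have "b j = b n0" using K(1) that by auto
        then show ?thesis using b(2)[of j] by simp
      qed
      then show "\<omega> \<in> {\<omega> \<in> space P. \<forall>j\<in>K. \<theta> j \<omega> \<in> cell ?q (b n0)}" using elim by simp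
    qed
    then show ?case using K L by (intro full_event_not_colourable[where \<kappa>="radial_class L (r n0)"]) auto
  qed
qed

text \<open>
  Disjoint groups of angles are independent.
\<close>

lemma prob_no_full_event:
  assumes F: "finite F" and K: "\<And>m. m \<in> F \<Longrightarrow> finite (K m)" and disj: "disjoint_family_on K F"
  shows "prob (space P - (\<Union>m\<in>F. full_event M (K m) (q m))) = (\<Prod>m\<in>F. 1 - prob (full_event M (K m) (q m)))"
proof (cases "F = {}")
  case True
  then show ?thesis by (simp add: prob_space)
next
  case False
  let ?X = "\<lambda>m \<omega>. restrict (\<lambda>i. \<theta> i \<omega>) (K m)"
  let ?S = "\<lambda>m. PiM (K m) (\<lambda>_. borel :: (real^'d) measure)"
  define A where "A m = {x \<in> space (?S m). \<exists>b\<in>cells (q m). \<exists>T\<in>{T. T \<subseteq> K m \<and> card T = M + 1}. \<forall>j\<in>T. x j \<in> cell (q m) b}" for m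
  have A: "A m \<in> sets (?S m)" if m: "m \<in> F" for m
    unfolding A_def
  proof (intro sets.sets_Collect_finite_Ex finite_cells finite_group_subsets[OF K[OF m]])
    fix b T assume T: "T \<in> {T. T \<subseteq> K m \<and> card T = M + 1}"
    show "{x \<in> space (?S m). \<forall>j\<in>T. x j \<in> cell (q m) b} \<in> sets (?S m)"
    proof (intro sets.sets_Collect_finite_All)
      show "finite T" using T K[OF m] finite_subset by auto
      fix j assume "j \<in> T"
      then have "(\<lambda>x. x j) \<in> measurable (?S m) borel" using T by (intro measurable_component_singleton) auto
      from measurable_sets[OF this cell_measurable[of "q m" b]]
      show "{x \<in> space (?S m). x j \<in> cell (q m) b} \<in> sets (?S m)"
        by (simp add: vimage_def Int_def conj_commute)
    qed
  qed
  have pre: "?X m -` (space (?S m) - A m) \<inter> space P = space P - full_event M (K m) (q m)" for m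
  proof -
    have "?X m \<omega> \<in> A m \<longleftrightarrow> \<omega> \<in> full_event M (K m) (q m)" if "\<omega> \<in> space P" for \<omega>
    proof -
      have "?X m \<omega> \<in> A m \<longleftrightarrow> (\<exists>b\<in>cells (q m). \<exists>T\<in>{T. T \<subseteq> K m \<and> card T = M + 1}. \<forall>j\<in>T. ?X m \<omega> j \<in> cell (q m) b)"
        by (simp add: A_def space_PiM)
      also have "\<dots> \<longleftrightarrow> (\<exists>b\<in>cells (q m). \<exists>T\<in>{T. T \<subseteq> K m \<and> card T = M + 1}. \<forall>j\<in>T. \<theta> j \<omega> \<in> cell (q m) b)"
        by (intro bex_cong ball_cong refl) auto
      also have "\<dots> \<longleftrightarrow> \<omega> \<in> full_event M (K m) (q m)"
        using that by (simp add: full_event_def full_cell_event_def)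
      finally show ?thesis .
    qed
    then show ?thesis by (auto simp: space_PiM)
  qed
  have "indep_vars ?S ?X F"
    using indep by (rule indep_vars_restrict) (use disj in auto)
  then have "prob (\<Inter>m\<in>F. ?X m -` (space (?S m) - A m) \<inter> space P) = (\<Prod>m\<in>F. prob (?X m -` (space (?S m) - A m) \<inter> space P))"
    using F False A by (intro indep_varsD[where M'="?S"]) auto
  moreover have "(\<Inter>m\<in>F. space P - full_event M (K m) (q m)) = space P - (\<Union>m\<in>F. full_event M (K m) (q m))"
    using False by auto
  ultimately show ?thesis
    unfolding pre using K by (simp add: prob_compl full_event_measurable)
qed

lemma prob_colourable_le_exp:
  assumes F: "finite F" and K: "\<And>m. m \<in> F \<Longrightarrow> finite (K m)"
    and sub: "\<And>m n. m \<in> F \<Longrightarrow> n \<in> K m \<Longrightarrow> level (r n) = m \<and> radial_class L (r n) = \<kappa> m"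
    and \<delta>: "32 / 2 ^ L < \<delta>"
  shows "prob {\<omega>\<in>space P. colourable M \<delta> (random_seq r \<theta> \<omega>)}
    \<le> exp (- (\<Sum>m\<in>F. prob (full_event M (K m) (refine L m))))"
proof -
  have disj: "disjoint_family_on K F" unfolding disjoint_family_on_def using sub by blast
  have ev: "(\<Union>m\<in>F. full_event M (K m) (refine L m)) \<in> sets P"
    using F K by (intro sets.finite_UN full_event_measurable)
  have "prob {\<omega>\<in>space P. colourable M \<delta> (random_seq r \<theta> \<omega>)}
    \<le> prob (space P - (\<Union>m\<in>F. full_event M (K m) (refine L m)))"
  proof (rule finite_measure_mono)
    show "{\<omega>\<in>space P. colourable M \<delta> (random_seq r \<theta> \<omega>)} \<subseteq> space P - (\<Union>m\<in>F. full_event M (K m) (refine L m))"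
      using full_event_not_colourable[OF K sub _ \<delta>] by blast
  qed (use ev in auto)
  also have "\<dots> = (\<Prod>m\<in>F. 1 - prob (full_event M (K m) (refine L m)))"
    using F K disj by (rule prob_no_full_event)
  also have "\<dots> \<le> (\<Prod>m\<in>F. exp (- prob (full_event M (K m) (refine L m))))"
  proof (intro prod_mono conjI)
    fix m
    show "1 - prob (full_event M (K m) (refine L m)) \<le> exp (- prob (full_event M (K m) (refine L m)))"
      using exp_ge_add_one_self[of "- prob (full_event M (K m) (refine L m))"] by simp
  qed auto
  also have "\<dots> = exp (- (\<Sum>m\<in>F. prob (full_event M (K m) (refine L m))))"
    using F by (simp add: exp_sum sum_negf[symmetric])
  finally show ?thesis .
qed

text \<open>
  By the pigeonhole principle one radial class contains a fixed fraction of the points of the level,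
  and a suitable subset of it has a full cell with the required probability.  The threshold \<open>M * R\<close>
  ensures that the class has more than \<open>M\<close> points.
\<close>

lemma exists_group_with_likely_full_cell:
  fixes m :: "nat ^ 'd" and L M :: nat
  defines "R \<equiv> 2 ^ ((L + 1) * CARD('d)) :: nat"
  assumes M: "M \<ge> 1" and L: "(2 * real M + 2) ^ (M + 1) \<le> 2 ^ L"
    and fin: "finite {n. level (r n) = m}" and large: "M * R < card {n. level (r n) = m}"
  shows "\<exists>K \<kappa>. finite K \<and> (\<forall>n\<in>K. level (r n) = m \<and> radial_class L (r n) = \<kappa>)
    \<and> 1 / (16 * (real M + 2) ^ (M + 1) * real R ^ (M + 1) * 2 ^ (CARD('d) * L * M))
        * min 1 (real (card {n. level (r n) = m}) ^ (1 + M) / 2 ^ (M * weight m))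
      \<le> prob (full_event M K (refine L m))"
proof -
  let ?X = "{n. level (r n) = m}" and ?q = "refine L m"
  define B :: real where "B = 2 ^ weight ?q"
  define c1 :: real where "c1 = 1 / (4 * (real M + 2) ^ (M + 1))"
  define c2 :: real where "c2 = 1 / (real R ^ (M + 1) * 2 ^ (CARD('d) * L * M))"
  define t where "t = real (card ?X) ^ (1 + M) / 2 ^ (M * weight m)"
  have R: "0 < R" by (simp add: R_def)
  have "(\<lambda>n. radial_class L (r n)) ` ?X \<subseteq> radial_classes L" using radii radial_class_in by blast
  from pigeonhole_fibre[OF fin finite_radial_classes this, of M] large
  obtain \<kappa> where \<kappa>: "M < card {n\<in>?X. radial_class L (r n) = \<kappa>}" "card ?X \<le> R * card {n\<in>?X. radial_class L (r n) = \<kappa>}"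
    by (auto simp: card_radial_classes R_def)
  let ?Y = "{n\<in>?X. radial_class L (r n) = \<kappa>}"
  have "(2::real) ^ L \<le> B"
    unfolding B_def weight_refine by (intro power_increasing) (auto simp: trans_le_add2)
  then have "(2 * real M + 2) ^ (M + 1) \<le> B" using L by simp
  from group_size_exists[OF M this \<kappa>(1)] obtain n
    where n: "n \<le> card ?Y" "real n \<le> B / 2" "real (n choose (M + 1)) / B ^ M \<le> 1/4"
      "c1 * min 1 (real (card ?Y) ^ (M + 1) / B ^ M) \<le> real (n choose (M + 1)) / B ^ M"
    unfolding c1_def by blast
  obtain K where K: "K \<subseteq> ?Y" "card K = n" using obtain_subset_with_card_n[OF n(1)] by blast
  have fK: "finite K" using fin by (intro finite_subset[OF K(1)]) simp
  have "real (card K choose (M + 1)) / B ^ M / 4 \<le> prob (full_event M K ?q)"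
    using n(2,3) fK K(2) unfolding B_def by (intro prob_full_event_ge) auto
  then have p: "c1 / 4 * min 1 (real (card ?Y) ^ (M + 1) / B ^ M) \<le> prob (full_event M K ?q)"
    using n(4) K(2) by simp
  have c2: "0 \<le> c2" "c2 \<le> 1"
  proof -
    have "1 * 1 \<le> real R ^ (M + 1) * 2 ^ (CARD('d) * L * M)"
      using R by (intro mult_mono one_le_power) auto
    then show "c2 \<le> 1" by (simp add: c2_def divide_le_eq_1)
  qed (simp add: c2_def)
  have "c2 * t \<le> real (card ?Y) ^ (M + 1) / B ^ M"
  proof -
    have BM: "B ^ M = 2 ^ (M * weight m) * 2 ^ (CARD('d) * L * M)"
      unfolding B_def weight_refine power_mult[symmetric] power_add[symmetric]
      by (rule arg_cong[where f="power 2"]) (simp add: algebra_simps)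
    have "real (card ?X) \<le> real R * real (card ?Y)" using of_nat_mono[OF \<kappa>(2), where 'a=real] by simp
    then have "real (card ?X) ^ (M + 1) \<le> (real R * real (card ?Y)) ^ (M + 1)" by (intro power_mono) auto
    then have "real (card ?X) ^ (M + 1) / real R ^ (M + 1) \<le> real (card ?Y) ^ (M + 1)"
      using R unfolding power_mult_distrib by (simp add: pos_divide_le_eq mult.commute)
    then have "real (card ?X) ^ (M + 1) / real R ^ (M + 1) / B ^ M \<le> real (card ?Y) ^ (M + 1) / B ^ M"
      by (intro divide_right_mono) (auto simp: B_def)
    moreover have "c2 * t = real (card ?X) ^ (M + 1) / real R ^ (M + 1) / B ^ M"
      unfolding c2_def t_def BM by simp
    ultimately show ?thesis by simp
  qed
  moreover have "c2 * min 1 t \<le> min 1 (c2 * t)"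
  proof -
    have "c2 * min 1 t \<le> c2 * 1" "c2 * min 1 t \<le> c2 * t" 
      using c2 mult_left_mono[of "min 1 t" 1 c2] mult_left_mono[of "min 1 t" t c2] by auto
    then show ?thesis using c2 by simp
  qed
  ultimately have "c2 * min 1 t \<le> min 1 (real (card ?Y) ^ (M + 1) / B ^ M)" by simp
  then have "c1 / 4 * (c2 * min 1 t) \<le> c1 / 4 * min 1 (real (card ?Y) ^ (M + 1) / B ^ M)"
    by (intro mult_left_mono) (auto simp: c1_def)
  with p have "c1 / 4 * (c2 * min 1 t) \<le> prob (full_event M K ?q)" by linarith
  moreover have "c1 / 4 * (c2 * min 1 t) = 1 / (16 * (real M + 2) ^ (M + 1) * real R ^ (M + 1) * 2 ^ (CARD('d) * L * M)) * min 1 t"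
    by (simp add: c1_def c2_def)
  ultimately have "1 / (16 * (real M + 2) ^ (M + 1) * real R ^ (M + 1) * 2 ^ (CARD('d) * L * M)) * min 1 t
      \<le> prob (full_event M K ?q)" by (simp only:)
  moreover have "\<forall>n\<in>K. level (r n) = m \<and> radial_class L (r n) = \<kappa>" using K(1) by blast
  ultimately show ?thesis using fK unfolding t_def by blast
qed

text \<open>
  The second Borel--Cantelli lemma in quantitative form: by independence the probability that no full
  cell occurs on finitely many levels is at most the exponential of minus the sum of the
  probabilities, and these sums are unbounded.
\<close>

lemma prob_colourable_eq_0_if_sum_unbounded:
  assumes M: "M \<ge> 1" and \<delta>: "0 < \<delta>"
    and fin: "\<And>m. finite {n. level (r n) = m}"
    and unbounded: "\<And>S. \<exists>F. finite F \<and>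
      S < (\<Sum>m\<in>F. real (card {n. level (r n) = m}) ^ (1 + M) / 2 ^ (M * weight m))"
  shows "prob {\<omega>\<in>space P. colourable M \<delta> (random_seq r \<theta> \<omega>)} = 0"
proof -
  let ?N = "\<lambda>m. card {n. level (r n) = m}"
  let ?t = "\<lambda>m. real (?N m) ^ (1 + M) / 2 ^ (M * weight m)"
  let ?p = "prob {\<omega>\<in>space P. colourable M \<delta> (random_seq r \<theta> \<omega>)}"
  have "(1::real) < 2" by simp
  \<comment> \<open>The first bound makes the cells small, the second makes them numerous enough for Bonferroni.\<close>
  from real_arch_pow[OF this] obtain L where "max (32 / \<delta>) ((2 * real M + 2) ^ (M + 1)) < 2 ^ L" by blast
  then have L: "32 / 2 ^ L < \<delta>" "(2 * real M + 2) ^ (M + 1) \<le> 2 ^ L" using \<delta> by (simp_all add: field_simps)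
  define R :: nat where "R = 2 ^ ((L + 1) * CARD('d))"
  define c where "c = 1 / (16 * (real M + 2) ^ (M + 1) * real R ^ (M + 1) * 2 ^ (CARD('d) * L * M))"
  have c: "0 < c" by (simp add: c_def R_def)
  have "\<forall>m\<in>{m. M * R < ?N m}. \<exists>K \<kappa>. finite K \<and> (\<forall>n\<in>K. level (r n) = m \<and> radial_class L (r n) = \<kappa>)
      \<and> c * min 1 (?t m) \<le> prob (full_event M K (refine L m))"
    unfolding c_def R_def using exists_group_with_likely_full_cell[OF M L(2) fin] by simp
  from bchoice[OF this] obtain K where
    "\<forall>m\<in>{m. M * R < ?N m}. \<exists>\<kappa>. finite (K m) \<and> (\<forall>n\<in>K m. level (r n) = m \<and> radial_class L (r n) = \<kappa>)
      \<and> c * min 1 (?t m) \<le> prob (full_event M (K m) (refine L m))" ..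
  from bchoice[OF this] obtain \<kappa> where
    "\<forall>m\<in>{m. M * R < ?N m}. finite (K m) \<and> (\<forall>n\<in>K m. level (r n) = m \<and> radial_class L (r n) = \<kappa> m)
      \<and> c * min 1 (?t m) \<le> prob (full_event M (K m) (refine L m))" ..
  then have K: "\<And>m. M * R < ?N m \<Longrightarrow> finite (K m)"
    "\<And>m n. M * R < ?N m \<Longrightarrow> n \<in> K m \<Longrightarrow> level (r n) = m \<and> radial_class L (r n) = \<kappa> m"
    "\<And>m. M * R < ?N m \<Longrightarrow> c * min 1 (?t m) \<le> prob (full_event M (K m) (refine L m))"
    by blast+
  have le: "?p \<le> exp (- A)" for A
  proof -
    obtain F where F: "finite F" "F \<subseteq> {m. M * R < ?N m}" "A / c \<le> (\<Sum>m\<in>F. min 1 (?t m))"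
      using truncated_sum_unbounded[OF M unbounded] by blast
    have "A \<le> c * (\<Sum>m\<in>F. min 1 (?t m))" using F(3) c by (simp add: field_simps)
    also have "\<dots> = (\<Sum>m\<in>F. c * min 1 (?t m))" by (rule sum_distrib_left)
    also have "\<dots> \<le> (\<Sum>m\<in>F. prob (full_event M (K m) (refine L m)))"
      using F(2) by (intro sum_mono K(3)) blast
    finally have "exp (- (\<Sum>m\<in>F. prob (full_event M (K m) (refine L m)))) \<le> exp (- A)" by simp
    moreover have "?p \<le> exp (- (\<Sum>m\<in>F. prob (full_event M (K m) (refine L m))))"
    proof (rule prob_colourable_le_exp[OF F(1) _ _ L(1)])
      show "finite (K m)" if "m \<in> F" for m using K(1) F(2) that by blast
      show "level (r n) = m \<and> radial_class L (r n) = \<kappa> m" if "m \<in> F" "n \<in> K m" for m n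
        using K(2) F(2) that by blast
    qed
    ultimately show ?thesis by linarith
  qed
  have "?p \<le> 0"
  proof (rule ccontr)
    assume "\<not> ?p \<le> 0"
    then have "0 < ?p / 2" "?p / 2 < ?p" by auto
    then show False using le[of "- ln (?p / 2)"] by simp
  qed
  then show ?thesis using measure_le_0_iff by blast
qed

end

section \<open>The zero-one law\<close>

theorem theorem1p2:
  fixes P :: "'w measure"
    and r :: "nat \<Rightarrow> real ^ 'd::finite"
    and \<theta> :: "nat \<Rightarrow> 'w \<Rightarrow> real ^ 'd"
    and M :: nat
  assumes "prob_space P"
    and "\<And>n i. 0 < r n $ i \<and> r n $ i < 1"
    and "prob_space.indep_vars P (\<lambda>_. borel) \<theta> UNIV"
    and "\<And>n. distr P borel (\<theta> n) = uniform_measure lborel torus_cube"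
    and "M \<ge> 1"
  defines "E \<equiv> {\<omega> \<in> space P. union_of_separated M (random_seq r \<theta> \<omega>)}"
    and "S \<equiv> (\<Sum>\<^sub>\<infinity>m\<in>UNIV. counting_fun r m ^ (1 + M) / 2 ^ (M * weight m))"
  shows "E \<in> sets P
    \<and> (S < \<infinity> \<longrightarrow> measure P E = 1)
    \<and> (S = \<infinity> \<longrightarrow> measure P E = 0)"
proof -
  interpret random_torus_points P r \<theta>
    by (intro random_torus_points.intro random_torus_points_axioms.intro assms)
  let ?N = "\<lambda>m. card {n. level (r n) = m}"
  let ?t = "\<lambda>m. real (?N m) ^ (1 + M) / 2 ^ (M * weight m)"
  let ?C = "\<lambda>k. {\<omega>\<in>space P. colourable M (1 / real (Suc k)) (random_seq r \<theta> \<omega>)}"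
  have E_eq: "E = (\<Union>k. ?C k)"
    unfolding E_def using union_of_separated_iff_colourable[OF \<open>M \<ge> 1\<close>] by blast
  have C: "?C k \<in> sets P" for k by measurable
  then have E: "E \<in> sets P" unfolding E_eq by auto
  have S_eq: "S = (SUP F\<in>{F. finite F}. \<Sum>m\<in>F. counting_fun r m ^ (1 + M) / 2 ^ (M * weight m))"
    unfolding S_def by (subst nonneg_infsum_complete) auto
  have term_eq: "counting_fun r m ^ (1 + M) / 2 ^ (M * weight m) = ennreal (?t m)" if "finite {n. level (r n) = m}" for m
  proof -
    have "counting_fun r m = ennreal (real (?N m))"
      using that assms(2) by (simp add: counting_fun_eq ennreal_of_nat_eq_real_of_nat)
    moreover have "(2::ennreal) ^ (M * weight m) = ennreal (2 ^ (M * weight m))"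
      by (simp add: ennreal_power[symmetric])
    ultimately show ?thesis by (simp only: ennreal_power divide_ennreal) (simp add: divide_ennreal ennreal_power)
  qed
  have one: "measure P E = 1" if "S < \<infinity>"
  proof -
    have le: "(\<Sum>m\<in>F. counting_fun r m ^ (1 + M) / 2 ^ (M * weight m)) \<le> S" if "finite F" for F
      unfolding S_eq using that by (intro SUP_upper) auto
    have fin: "finite {n. level (r n) = m}" for m
    proof (rule ccontr)
      assume "infinite {n. level (r n) = m}"
      then have "counting_fun r m = \<infinity>" using assms(2) by (simp add: counting_fun_eq)
      then have "counting_fun r m ^ (1 + M) / 2 ^ (M * weight m) = \<infinity>"
        by (simp add: ennreal_top_mult ennreal_divide_eq_top_iff power_eq_top_ennreal)
      then show False using le[of "{m}"] \<open>S < \<infinity>\<close> by (simp add: top_unique)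
    qed
    have bound: "(\<Sum>m\<in>F. ?t m) \<le> enn2real S" if "finite F" for F
    proof -
      have "ennreal (\<Sum>m\<in>F. ?t m) = (\<Sum>m\<in>F. counting_fun r m ^ (1 + M) / 2 ^ (M * weight m))"
        using fin by (simp only: term_eq) (rule sum_ennreal[symmetric], simp)
      also have "\<dots> \<le> S" by (rule le[OF that])
      finally have "enn2real (ennreal (\<Sum>m\<in>F. ?t m)) \<le> enn2real S"
        using \<open>S < \<infinity>\<close> by (intro enn2real_mono) auto
      then show ?thesis by (simp add: sum_nonneg)
    qed
    have "AE \<omega> in P. \<exists>k. colourable M (1 / real (Suc k)) (random_seq r \<theta> \<omega>)"
      by (rule AE_colourable_if_sum_bounded[OF \<open>M \<ge> 1\<close> fin bound])
    then have "AE \<omega> in P. \<omega> \<in> E"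
      using AE_space by eventually_elim (simp add: E_eq)
    then show ?thesis using E by (simp add: prob_eq_1)
  qed
  have zero: "measure P E = 0" if "S = \<infinity>"
  proof -
    have "AE \<omega> in P. \<omega> \<notin> ?C k" for k
    proof (cases "\<forall>m. finite {n. level (r n) = m}")
      case False
      then obtain m where "infinite {n. level (r n) = m}" by blast
      from AE_not_colourable_if_infinite_level[OF this, of "1 / real (Suc k)" M] show ?thesis
        by (auto elim: eventually_mono)
    next
      case True
      have "\<exists>F. finite F \<and> A < (\<Sum>m\<in>F. ?t m)" for A
      proof -
        have "ennreal \<bar>A\<bar> < S" using \<open>S = \<infinity>\<close> by simp
        then obtain F where F: "finite F" "ennreal \<bar>A\<bar> < (\<Sum>m\<in>F. counting_fun r m ^ (1 + M) / 2 ^ (M * weight m))"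
          unfolding S_eq less_SUP_iff by blast
        have "(\<Sum>m\<in>F. counting_fun r m ^ (1 + M) / 2 ^ (M * weight m)) = ennreal (\<Sum>m\<in>F. ?t m)"
          using True by (simp only: term_eq) (rule sum_ennreal, simp)
        then have "\<bar>A\<bar> < (\<Sum>m\<in>F. ?t m)" using F(2) by (simp add: ennreal_less_iff)
        then show ?thesis using F(1) by (intro exI[of _ F]) auto
      qed
      then have "prob (?C k) = 0"
        using True \<open>M \<ge> 1\<close> by (intro prob_colourable_eq_0_if_sum_unbounded) auto
      then show ?thesis using C prob_eq_0 by blast
    qed
    then have "AE \<omega> in P. \<forall>k. \<omega> \<notin> ?C k" by (simp add: AE_all_countable)
    then have "AE \<omega> in P. \<omega> \<notin> E" by (simp add: E_eq)
    then show ?thesis using E by (simp add: prob_eq_0)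
  qed
  show ?thesis using E one zero by blast
qed

end
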